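(* Let $m \ge 3$ and $n, k \ge 1$, and let $T_{m,n,k}$ be the graph obtained from the disjoint union of a cycle $C_m$ and paths $P_n$ and $P_k$ by choosing two adjacent vertices $a,b$ of $C_m$ and adding an edge from $a$ to an end-vertex of $P_n$ and an edge from $b$ to an end-vertex of $P_k$. Then $\gamma_g(T_{m,n,k}) \le \left\lceil \frac{n(T_{m,n,k})}{2}\right\rceil$, where $n(T_{m,n,k}) = m+n+k$.
   Context: The domination game on a graph $G$ is played by Dominator and Staller, who alternately select vertices of $G$; each selected vertex must dominate (i.e., be equal or adjacent to) at least one vertex not dominated by the previously selected vertices. The game ends when no such move is possible. Dominator wants to minimize the number of moves, Staller to maximize it. $\gamma_g(G)$ is the number of moves when both play optimally and Dominator makes the first move. $n(G)$ denotes the number of vertices of $G$. *)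

theory Defs
  imports Complex_Main "Graph_Theory.Graph_Theory"
begin

section \<open>The domination game\<close>

text \<open>Graphs are the finite simple graphs of \<^theory>\<open>Graph_Theory.Pair_Digraph\<close>, that is,
  structures satisfying \<^locale>\<open>pair_graph\<close>: an edge is a pair of mutually opposite arcs.\<close>

definition closed_nbhd :: "'a pair_pre_digraph \<Rightarrow> 'a \<Rightarrow> 'a set" where
  "closed_nbhd G v = insert v {u. (v, u) \<in> parcs G}"

definition dominated_by :: "'a pair_pre_digraph \<Rightarrow> 'a set \<Rightarrow> 'a set" where
  "dominated_by G S = (\<Union>v\<in>S. closed_nbhd G v)"

definition legal_moves :: "'a pair_pre_digraph \<Rightarrow> 'a set \<Rightarrow> 'a set" where
  "legal_moves G S = {v \<in> pverts G. \<exists>u \<in> closed_nbhd G v. u \<notin> dominated_by G S}"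

datatype player = Dominator | Staller

fun opponent :: "player \<Rightarrow> player" where
  "opponent Dominator = Staller"
| "opponent Staller = Dominator"

fun optimum :: "player \<Rightarrow> nat set \<Rightarrow> nat" where
  "optimum Dominator = Min"
| "optimum Staller = Max"

text \<open>\<open>moves_left G p S\<close> is the number of moves still to be made under optimal play when \<open>p\<close> is
  to move and \<open>S\<close> is the set of vertices selected so far.  The finiteness test only makes the
  function total; on a finite graph the value is 0 exactly if there is no legal move.\<close>

function moves_left :: "'a pair_pre_digraph \<Rightarrow> player \<Rightarrow> 'a set \<Rightarrow> nat" where
  "moves_left G p S =
    (if finite (pverts G) \<and> legal_moves G S \<noteq> {}
     then Suc (optimum p ((\<lambda>v. moves_left G (opponent p) (insert v S)) ` legal_moves G S))
     else 0)"
  by pat_completeness auto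
termination
proof (relation "measure (\<lambda>(G, p, S). card (pverts G - S))", goal_cases)
  case 1
  show ?case by simp
next
  case (2 G p S v)
  then have "v \<in> pverts G" "v \<notin> S"
    by (auto simp: legal_moves_def dominated_by_def)
  then have "pverts G - insert v S \<subset> pverts G - S"
    by auto
  with 2 show ?case
    by (auto intro: psubset_card_mono)
qed

declare moves_left.simps [simp del]

definition game_domination_number :: "'a pair_pre_digraph \<Rightarrow> nat" where
  "game_domination_number G = moves_left G Dominator {}"


section \<open>A cycle with two pendant paths at adjacent vertices\<close>

definition cycle_graph :: "nat \<Rightarrow> nat pair_pre_digraph" where
  "cycle_graph m = mk_symmetric (with_proj
     \<lparr>pverts = {..<m}, parcs = {(i, Suc i mod m) | i. i < m}\<rparr>)"

definition path_graph :: "nat \<Rightarrow> nat pair_pre_digraph" where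
  "path_graph n = mk_symmetric (with_proj
     \<lparr>pverts = {..<n}, parcs = {(i, Suc i) | i. Suc i < n}\<rparr>)"

text \<open>The path on one vertex has that vertex as its only end-vertex.\<close>

definition path_ends :: "nat \<Rightarrow> nat set" where
  "path_ends n = {0, n - 1}"

definition disjoint_union ::
    "'a pair_pre_digraph \<Rightarrow> 'b pair_pre_digraph \<Rightarrow> ('a + 'b) pair_pre_digraph" where
  "disjoint_union G H =
     \<lparr>pverts = pverts G <+> pverts H,
      parcs = map_prod Inl Inl ` parcs G \<union> map_prod Inr Inr ` parcs H\<rparr>"

definition add_edge :: "'a \<Rightarrow> 'a \<Rightarrow> 'a pair_pre_digraph \<Rightarrow> 'a pair_pre_digraph" where
  "add_edge u v G = G\<lparr>parcs := parcs G \<union> {(u, v), (v, u)}\<rparr>"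

text \<open>The graph \<open>T\<^bsub>m,n,k\<^esub>\<close>, with the cycle vertices \<open>a\<close> and \<open>b\<close> and the path vertices \<open>p\<close> and \<open>q\<close>
  that are joined to them as explicit parameters.\<close>

definition T_graph ::
    "nat \<Rightarrow> nat \<Rightarrow> nat \<Rightarrow> nat \<Rightarrow> nat \<Rightarrow> nat \<Rightarrow> nat \<Rightarrow> (nat + nat + nat) pair_pre_digraph" where
  "T_graph m n k a b p q =
     add_edge (Inl a) (Inr (Inl p)) (add_edge (Inl b) (Inr (Inr q))
       (disjoint_union (cycle_graph m) (disjoint_union (path_graph n) (path_graph k))))"

lemma pair_graph_T_graph:
  assumes "m \<ge> 3" "a < m" "b < m" "p < n" "q < k"
  shows "pair_graph (T_graph m n k a b p q)"
proof -
  have V: "pverts (T_graph m n k a b p q) = {..<m} <+> {..<n} <+> {..<k}"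
    by (simp add: T_graph_def add_edge_def disjoint_union_def cycle_graph_def path_graph_def)
  have cyc: "(u, v) \<in> parcs (cycle_graph m) \<longleftrightarrow>
      (u < m \<and> v = Suc u mod m) \<or> (v < m \<and> u = Suc v mod m)" for u v
    by (auto simp: cycle_graph_def parcs_mk_symmetric)
  have path: "(u, v) \<in> parcs (path_graph j) \<longleftrightarrow>
      (Suc u < j \<and> v = Suc u) \<or> (Suc v < j \<and> u = Suc v)" for u v j
    by (auto simp: path_graph_def parcs_mk_symmetric)
  have cyc': "u < m \<and> v < m \<and> u \<noteq> v \<and> (v, u) \<in> parcs (cycle_graph m)"
    if "(u, v) \<in> parcs (cycle_graph m)" for u v
    using that assms(1) by (auto simp: cyc mod_Suc split: if_splits)
  have path': "u < j \<and> v < j \<and> u \<noteq> v \<and> (v, u) \<in> parcs (path_graph j)"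
    if "(u, v) \<in> parcs (path_graph j)" for u v j
    using that by (auto simp: path)
  have E: "e \<in> parcs (T_graph m n k a b p q) \<longleftrightarrow>
      e \<in> {(Inl a, Inr (Inl p)), (Inr (Inl p), Inl a), (Inl b, Inr (Inr q)), (Inr (Inr q), Inl b)} \<or>
      (\<exists>u v. e = (Inl u, Inl v) \<and> (u, v) \<in> parcs (cycle_graph m)) \<or>
      (\<exists>u v. e = (Inr (Inl u), Inr (Inl v)) \<and> (u, v) \<in> parcs (path_graph n)) \<or>
      (\<exists>u v. e = (Inr (Inr u), Inr (Inr v)) \<and> (u, v) \<in> parcs (path_graph k))" for e
    unfolding T_graph_def add_edge_def disjoint_union_def by (auto simp: image_iff) force+
  have wf: "fst e \<in> pverts (T_graph m n k a b p q) \<and> snd e \<in> pverts (T_graph m n k a b p q) \<and>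
      fst e \<noteq> snd e \<and> (snd e, fst e) \<in> parcs (T_graph m n k a b p q)"
    if "e \<in> parcs (T_graph m n k a b p q)" for e
    using that assms(2-) unfolding E V by (auto dest: cyc' path')
  have fin: "finite (pverts (T_graph m n k a b p q))"
    by (simp add: V)
  have "parcs (T_graph m n k a b p q)
      \<subseteq> pverts (T_graph m n k a b p q) \<times> pverts (T_graph m n k a b p q)"
    using wf by (auto simp: mem_Times_iff)
  with fin have fin': "finite (parcs (T_graph m n k a b p q))"
    using finite_subset by blast
  have sym: "sym (parcs (T_graph m n k a b p q))"
    using wf by (force intro: symI)
  show ?thesis
    by unfold_locales (use wf fin fin' sym in \<open>auto simp: symmetric_def\<close>)
qed

end

theory Submission
  imports Defs
begin

text \<open>The graph is a Hamiltonian path with the chord \<open>ab\<close>. As soon as \<open>a\<close> and \<open>b\<close> are both dominated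
  the chord is irrelevant, and the position is described by the lengths of the maximal runs of
  undominated vertices on the path. For such positions a potential depending only on the run
  lengths and their residues modulo 4 bounds the number of remaining moves.

  Dominator starts at \<open>a\<close>, which leaves runs of lengths \<open>n - 1\<close>, \<open>m - 3\<close> and \<open>k\<close>, or symmetrically at \<open>b\<close>.
  The potential is small enough for one of the two choices except in a few residue classes. In all
  but one of these one uses that Staller's first reply cannot shorten the run of length \<open>k\<close> by exactly
  one vertex without changing another run: this run ends in an undominated leaf, and at its other end
  only the move \<open>b\<close> does it, which shortens the middle run as well. If \<open>m\<close>, \<open>n\<close> and \<open>k\<close> are all 2
  modulo 4, Dominator starts at the path neighbour of \<open>a\<close> and aims at the path neighbour of \<open>b\<close>; by the
  continuation principle Staller's reply in between costs at most one move.\<close>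

section \<open>Runs of undominated vertices\<close>

text \<open>Two adjacent dominated positions enclose a run of length 0, which is listed as well.\<close>

fun runs :: "nat \<Rightarrow> bool list \<Rightarrow> nat list" where
  "runs c [] = [c]"
| "runs c (True # w) = runs (Suc c) w"
| "runs c (False # w) = c # runs 0 w"

lemma runs_replicate: "runs c (replicate r True @ w) = runs (c + r) w"
  by (induction r arbitrary: c) auto

lemma runs_append_False: "runs c (u @ False # v) = runs c u @ runs 0 v"
proof (induction u arbitrary: c)
  case (Cons x u)
  then show ?case by (cases x) auto
qed auto

text \<open>A prefix yields finished runs \<open>C\<close> and an open run \<open>i\<close> that do
  not depend on what follows. Together with \<open>runs_shift\<close> this confines the effect of a
  move to its window and the two runs that reach it.\<close>

lemma runs_append: "\<exists>C i. \<forall>z. runs c (x @ z) = C @ runs i z"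
proof (induction x arbitrary: c)
  case Nil
  show ?case by (rule exI[of _ "[]"], rule exI[of _ c]) simp
next
  case (Cons b x)
  show ?case
  proof (cases b)
    case True
    then show ?thesis using Cons[of "Suc c"] by auto
  next
    case False
    obtain C i where "\<forall>z. runs 0 (x @ z) = C @ runs i z" using Cons by blast
    then show ?thesis using False by (intro exI[of _ "c # C"] exI[of _ i]) auto
  qed
qed

lemma runs_shift: "\<exists>D j. \<forall>c. runs c y = (c + j) # D"
proof (induction y)
  case Nil
  show ?case by (rule exI[of _ "[]"], rule exI[of _ 0]) simp
next
  case (Cons b y)
  then obtain D j where D: "\<forall>c. runs c y = (c + j) # D" by blast
  show ?case
  proof (cases b)
    case True
    then show ?thesis using D by (intro exI[of _ D] exI[of _ "Suc j"]) auto
  next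
    case False
    then show ?thesis by (intro exI[of _ "runs 0 y"] exI[of _ 0]) auto
  qed
qed

text \<open>The appended \<open>False\<close> closes the last block. The first alternative is the
  run that the accumulator \<open>c\<close> has already begun; \<open>r = 0\<close> covers the empty
  run after the final \<open>False\<close>.\<close>

lemma run_occurs:
  assumes "r \<in> set (runs c (w @ [False]))"
  shows "(\<exists>s y. w @ [False] = replicate s True @ False # y \<and> r = c + s) \<or> r = 0 \<or>
         (\<exists>x y. w @ [False] = x @ False # replicate r True @ False # y)"
  using assms
proof (induction w arbitrary: c)
  case Nil
  then show ?case by (auto intro!: exI[of _ 0])
next
  case (Cons b w)
  show ?case
  proof (cases b)
    case True
    then have "r \<in> set (runs (Suc c) (w @ [False]))" using Cons.prems by simp
    from Cons.IH[OF this] show ?thesis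
    proof (elim disjE exE conjE)
      fix s y assume "w @ [False] = replicate s True @ False # y" "r = Suc c + s"
      then show ?thesis using True by (intro disjI1 exI[of _ "Suc s"] exI[of _ y]) auto
    next
      fix x y assume "w @ [False] = x @ False # replicate r True @ False # y"
      then show ?thesis using True by (intro disjI2 exI[of _ "b # x"] exI[of _ y]) auto
    qed simp
  next
    case False
    then have "r = c \<or> r \<in> set (runs 0 (w @ [False]))" using Cons.prems by simp
    then show ?thesis
    proof
      assume "r = c"
      then show ?thesis using False by (intro disjI1 exI[of _ 0] exI[of _ "w @ [False]"]) auto
    next
      assume "r \<in> set (runs 0 (w @ [False]))"
      from Cons.IH[OF this] show ?thesis
      proof (elim disjE exE conjE)
        fix s y assume "w @ [False] = replicate s True @ False # y" "r = 0 + s"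
        then show ?thesis using False by (intro disjI2 exI[of _ "[]"] exI[of _ y]) auto
      next
        fix x y assume "w @ [False] = x @ False # replicate r True @ False # y"
        then show ?thesis using False by (intro disjI2 exI[of _ "b # x"] exI[of _ y]) auto
      qed simp
    qed
  qed
qed

section \<open>The potential\<close>

text \<open>With \<open>A\<close> the sum of the weights and \<open>t\<close> the sum of the debts of the runs, twice the number of
  moves left is at most \<open>A + pot_S t\<close> when Staller is to move, and at most
  \<open>A + pot_D t - 1\<close> when Dominator is to move. The functions were found by tabulating
  the values of small unions of runs.\<close>

definition weight :: "nat \<Rightarrow> nat" where
  "weight r = r + (if r mod 4 = 1 then 1 else 0)"

definition debt :: "nat \<Rightarrow> nat" where
  "debt r = (if r mod 4 = 2 then 2 else if r mod 4 = 3 then 1 else 0)"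

definition pot_S :: "nat \<Rightarrow> nat" where
  "pot_S t = t mod 4 + 2 * (t div 4)"

definition pot_D :: "nat \<Rightarrow> nat" where
  "pot_D t = (if t = 0 then 1 else pot_S (t - 1))"

abbreviation total :: "(nat \<Rightarrow> nat) \<Rightarrow> bool list \<Rightarrow> nat" where
  "total f w \<equiv> sum_list (map f (runs 0 w))"

lemma mod4_cases:
  fixes r :: nat
  obtains q s where "r = 4 * q + s" "s \<in> {0, 1, 2, 3}"
proof
  show "r = 4 * (r div 4) + r mod 4" by simp
  have "r mod 4 < 4" by simp
  then show "r mod 4 \<in> {0, 1, 2, 3}" by (simp only: insert_iff empty_iff) linarith
qed

lemma weight_period: "weight (4 * q + s) = 4 * q + weight s"
  by (simp add: weight_def)

lemma debt_period: "debt (4 * q + s) = debt s"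
  by (simp add: debt_def)

lemma pot_S_period: "pot_S (4 * q + s) = 2 * q + pot_S s"
  by (simp add: pot_S_def)

text \<open>The value 1 at 0 is what \<open>t mod 4 + 2 * (t div 4)\<close> gives over the integers
  at -1, so \<open>pot_D\<close> is \<open>pot_S\<close> shifted by one and has the same
  period.\<close>

lemma pot_D_period: "pot_D (4 * q + s) = 2 * q + pot_D s"
proof (cases "s = 0")
  case True
  show ?thesis
  proof (cases q)
    case (Suc p)
    then have "4 * q + s - 1 = 4 * p + 3" using True by simp
    then show ?thesis using True Suc by (simp add: pot_D_def pot_S_period) (simp add: pot_S_def)
  qed (use True in simp)
next
  case False
  then have "4 * q + s - 1 = 4 * q + (s - 1)" by simp
  then have "pot_S (4 * q + s - 1) = 2 * q + pot_S (s - 1)" by (simp only: pot_S_period)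
  then show ?thesis using False by (simp add: pot_D_def)
qed

text \<open>Lengthening a run by 4 adds 4 to its weight and keeps its debt; raising the total debt
  by 4 adds 2 to either potential. Inequalities in which these increments balance become finite
  checks over residues, done by \<open>code_simp\<close>.\<close>

lemmas period = weight_period debt_period pot_S_period pot_D_period

section \<open>Staller's moves and the potential\<close>

text \<open>Staller takes \<open>d\<close> vertices off one end of a run; \<open>t\<close> is the
  debt of the other runs. The move counts 2 and Dominator's bound has the offset -1, hence the
  \<open>+ 1\<close> here and in the next two lemmas.\<close>

lemma shrink_run:
  assumes "d \<in> {1, 2}"
  shows "weight i + pot_D (t + debt i) + 1 \<le> weight (i + d) + pot_S (t + debt (i + d))"
proof -
  obtain q s where i: "i = 4 * q + s" and s: "s \<in> {0, 1, 2, 3}" by (rule mod4_cases)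
  obtain p u where t: "t = 4 * p + u" and u: "u \<in> {0, 1, 2, 3}" by (rule mod4_cases)
  have "\<forall>s\<in>{0, 1, 2, 3}. \<forall>u\<in>{0, 1, 2, 3}. \<forall>d\<in>{1, 2}.
      weight s + pot_D (u + debt s) + 1 \<le> weight (s + d) + pot_S (u + debt (s + d))"
    by code_simp
  with s u assms have "weight s + pot_D (u + debt s) + 1 \<le> weight (s + d) + pot_S (u + debt (s + d))"
    by blast
  then show ?thesis
    unfolding i t add.assoc period by linarith
qed

lemma split_run:
  "weight i + weight j + pot_D (t + (debt i + debt j)) + 1 \<le> weight (i + j + 3) + pot_S (t + debt (i + j + 3))"
proof -
  obtain q s where i: "i = 4 * q + s" and s: "s \<in> {0, 1, 2, 3}" by (rule mod4_cases)
  obtain q' s' where j: "j = 4 * q' + s'" and s': "s' \<in> {0, 1, 2, 3}" by (rule mod4_cases)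
  obtain p u where t: "t = 4 * p + u" and u: "u \<in> {0, 1, 2, 3}" by (rule mod4_cases)
  have "\<forall>s\<in>{0, 1, 2, 3}. \<forall>s'\<in>{0, 1, 2, 3}. \<forall>u\<in>{0, 1, 2, 3}.
      weight s + weight s' + pot_D (u + (debt s + debt s')) + 1
        \<le> weight (s + s' + 3) + pot_S (u + debt (s + s' + 3))"
    by code_simp
  with s s' u have "weight s + weight s' + pot_D (u + (debt s + debt s')) + 1
        \<le> weight (s + s' + 3) + pot_S (u + debt (s + s' + 3))"
    by blast
  moreover have ij: "i + j + 3 = 4 * (q + q') + (s + s' + 3)" by (simp add: i j)
  ultimately show ?thesis
    unfolding ij unfolding i j t add.assoc period by (simp add: add.assoc)
qed

text \<open>This is the move at a lone dominated vertex between two runs, each of which loses one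
  vertex.\<close>

lemma join_runs:
  "weight i + weight j + pot_D (t + (debt i + debt j)) + 1
    \<le> weight (i + 1) + weight (j + 1) + pot_S (t + (debt (i + 1) + debt (j + 1)))"
proof -
  obtain q s where i: "i = 4 * q + s" and s: "s \<in> {0, 1, 2, 3}" by (rule mod4_cases)
  obtain q' s' where j: "j = 4 * q' + s'" and s': "s' \<in> {0, 1, 2, 3}" by (rule mod4_cases)
  obtain p u where t: "t = 4 * p + u" and u: "u \<in> {0, 1, 2, 3}" by (rule mod4_cases)
  have "\<forall>s\<in>{0, 1, 2, 3}. \<forall>s'\<in>{0, 1, 2, 3}. \<forall>u\<in>{0, 1, 2, 3}.
      weight s + weight s' + pot_D (u + (debt s + debt s')) + 1
        \<le> weight (s + 1) + weight (s' + 1) + pot_S (u + (debt (s + 1) + debt (s' + 1)))"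
    by code_simp
  with s s' u have "weight s + weight s' + pot_D (u + (debt s + debt s')) + 1
        \<le> weight (s + 1) + weight (s' + 1) + pot_S (u + (debt (s + 1) + debt (s' + 1)))"
    by blast
  then show ?thesis
    unfolding i j t add.assoc period by linarith
qed

text \<open>The runs that reach the window from outside have parts \<open>i\<close> and
  \<open>j\<close> there; each of the seven patterns is an instance of one of the three preceding
  lemmas.\<close>

lemma staller_window:
  assumes "p \<or> q \<or> r"
  shows "total weight (x @ [False, False, False] @ y) + pot_D (total debt (x @ [False, False, False] @ y)) + 1
    \<le> total weight (x @ [p, q, r] @ y) + pot_S (total debt (x @ [p, q, r] @ y))"
proof -
  obtain C i where C: "\<And>z. runs 0 (x @ z) = C @ runs i z" using runs_append by blast
  obtain D j where D: "\<And>c. runs c y = (c + j) # D" using runs_shift by blast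
  let ?t = "sum_list (map debt C) + sum_list (map debt D)"
  have [simp]: "weight 0 = 0" "debt 0 = 0" by (simp_all add: weight_def debt_def)
  note [simp] = C D add_ac
  show ?thesis
  proof (cases p; cases q; cases r)
    assume "p" "q" "r"
    then show ?thesis using split_run[of i j ?t] by (simp add: eval_nat_numeral)
  next
    assume "p" "q" "\<not> r"
    then show ?thesis using shrink_run[of 2 i "?t + debt j"] by (simp add: eval_nat_numeral)
  next
    assume "p" "\<not> q" "r"
    then show ?thesis using join_runs[of i j ?t] by simp
  next
    assume "p" "\<not> q" "\<not> r"
    then show ?thesis using shrink_run[of 1 i "?t + debt j"] by simp
  next
    assume "\<not> p" "q" "r"
    then show ?thesis using shrink_run[of 2 j "?t + debt i"] by (simp add: eval_nat_numeral)
  next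
    assume "\<not> p" "q" "\<not> r"
    then show ?thesis using shrink_run[of 1 0 "?t + debt i + debt j"] by simp
  next
    assume "\<not> p" "\<not> q" "r"
    then show ?thesis using shrink_run[of 1 j "?t + debt i"] by simp
  qed (use assms in simp)
qed

section \<open>Dominator's choice of a run\<close>

text \<open>Dominator takes three vertices off an end of a run, or a shorter run entirely. The
  \<open>+ 3\<close> is 2 for the move and 1 for the offset in Dominator's bound. Not every run
  allows this gain, hence the conditions on \<open>r\<close> and on the debt \<open>t\<close> of the
  others.\<close>

lemma shoot_run:
  assumes "r > 0" "r mod 4 = 3 \<or> r mod 4 = 2 \<and> even t \<or> t = 0"
  shows "weight (r - 3) + pot_S (t + debt (r - 3)) + 3 \<le> weight r + pot_D (t + debt r)"
proof -
  obtain q s where r: "r = 4 * q + s" and s: "s \<in> {0, 1, 2, 3}" by (rule mod4_cases)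
  obtain p u where t: "t = 4 * p + u" and u: "u \<in> {0, 1, 2, 3}" by (rule mod4_cases)
  have "r mod 4 = s" using s r by auto
  then have cond: "s = 3 \<or> s = 2 \<and> u \<in> {0, 2} \<or> u = 0"
    using assms(2) u t by auto
  show ?thesis
  \<comment> \<open>For \<open>q = 0\<close> the subtraction truncates to 0; otherwise it borrows
    one period.\<close>
  proof (cases q)
    case 0
    have "\<forall>s\<in>{0, 1, 2, 3}. \<forall>u\<in>{0, 1, 2, 3}. 0 < s \<and> (s = 3 \<or> s = 2 \<and> u \<in> {0, 2} \<or> u = 0) \<longrightarrow>
        weight (s - 3) + pot_S (u + debt (s - 3)) + 3 \<le> weight s + pot_D (u + debt s)"
      by code_simp
    then have "weight (s - 3) + pot_S (u + debt (s - 3)) + 3 \<le> weight s + pot_D (u + debt s)"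
      using s u cond \<open>r > 0\<close> 0 r by fastforce
    then show ?thesis unfolding t add.assoc period using 0 r by simp
  next
    case (Suc q')
    have "\<forall>s\<in>{0, 1, 2, 3}. \<forall>u\<in>{0, 1, 2, 3}. s = 3 \<or> s = 2 \<and> u \<in> {0, 2} \<or> u = 0 \<longrightarrow>
        weight (s + 1) + pot_S (u + debt (s + 1)) + 3 \<le> 4 + weight s + pot_D (u + debt s)"
      by code_simp
    then have "weight (s + 1) + pot_S (u + debt (s + 1)) + 3 \<le> 4 + weight s + pot_D (u + debt s)"
      using s u cond by blast
    moreover have r3: "r - 3 = 4 * q' + (s + 1)" using r Suc by simp
    ultimately show ?thesis
      unfolding r3 unfolding t r add.assoc period using Suc by simp
  qed
qed

lemma nonzero_run: "True \<in> set w \<Longrightarrow> \<exists>r\<in>set (runs c w). r > 0"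
proof (induction w arbitrary: c)
  case (Cons b w)
  obtain D j where D: "\<And>c. runs c w = (c + j) # D" using runs_shift by blast
  show ?case using Cons by (cases b) (auto simp: D)
qed simp

lemma dominator_window:
  assumes "True \<in> set w" "w = False # v" "w = v' @ [False]"
  shows "\<exists>x p r y. w = x @ [p, True, r] @ y \<and>
    total weight (x @ [False, False, False] @ y) + pot_S (total debt (x @ [False, False, False] @ y)) + 3
      \<le> total weight w + pot_D (total debt w)"
proof -
  have [simp]: "weight 0 = 0" "debt 0 = 0" by (simp_all add: weight_def debt_def)
  obtain s where s: "s \<in> set (runs 0 w)" "s > 0" using nonzero_run[OF assms(1)] by blast
  \<comment> \<open>Order of preference: residue 3, then 2, then any nonempty run. Without residue 3
    all debts are even, and without 2 and 3 they vanish, which is what \<open>shoot_run\<close> asks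
    for.\<close>
  obtain r where r: "r \<in> set (runs 0 w)" "r > 0"
    and best: "r mod 4 = 3 \<or> (\<forall>s\<in>set (runs 0 w). s mod 4 \<noteq> 3) \<and> r mod 4 = 2 \<or>
      (\<forall>s\<in>set (runs 0 w). s mod 4 \<noteq> 3 \<and> s mod 4 \<noteq> 2)"
  proof (cases "\<exists>r\<in>set (runs 0 w). r mod 4 = 3")
    case True
    then obtain r where "r \<in> set (runs 0 w)" "r mod 4 = 3" by blast
    moreover then have "r > 0" by (auto intro: gr0I)
    ultimately show ?thesis using that by blast
  next
    case no3: False
    show ?thesis
    proof (cases "\<exists>r\<in>set (runs 0 w). r mod 4 = 2")
      case True
      then obtain r where "r \<in> set (runs 0 w)" "r mod 4 = 2" by blast
      moreover then have "r > 0" by (auto intro: gr0I)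
      ultimately show ?thesis using that no3 by blast
    next
      case False
      then show ?thesis using that s no3 by blast
    qed
  qed
  from run_occurs[of r 0 v'] r assms obtain x y where w: "w = x @ False # replicate r True @ False # y"
    by (cases r) auto
  let ?t = "sum_list (map debt (runs 0 x)) + sum_list (map debt (runs 0 y))"
  have runs_w: "runs 0 w = runs 0 x @ r # runs 0 y"
    by (simp add: w runs_append_False runs_replicate runs_replicate[of _ _ "[]", simplified])
  have "debt s = 0" if "s mod 4 \<noteq> 3" "s mod 4 \<noteq> 2" for s using that by (simp add: debt_def)
  moreover have "even (debt s)" if "s mod 4 \<noteq> 3" for s using that by (simp add: debt_def)
  moreover have "even (sum_list (map debt l))" if "\<forall>s\<in>set l. even (debt s)" for l
    using that by (induction l) auto
  moreover have "sum_list (map debt l) = 0" if "\<forall>s\<in>set l. debt s = 0" for l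
    using that by (induction l) auto
  ultimately have "r mod 4 = 3 \<or> r mod 4 = 2 \<and> even ?t \<or> ?t = 0"
    using best unfolding runs_w by simp blast
  from shoot_run[OF r(2) this]
  have *: "weight (r - 3) + pot_S (?t + debt (r - 3)) + 3 \<le> weight r + pot_D (?t + debt r)" .
  \<comment> \<open>The window covers the last three vertices of the run, or the whole run with
    dominated neighbours. Its middle is undominated in every case, so the move is legal.\<close>
  consider "r = 1" | "r = 2" | s where "r = s + 3" using r(2)
    by (metis One_nat_def Suc_1 add.commute add_Suc_right less_numeral_extra(3) nat_arith.rule0 not0_implies_Suc numeral_3_eq_3 plus_1_eq_Suc)
  then show ?thesis
  proof cases
    case 1
    have "w = x @ [False, True, False] @ y" by (simp add: w 1)
    moreover have "total weight (x @ [False, False, False] @ y) + pot_S (total debt (x @ [False, False, False] @ y)) + 3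
      \<le> total weight w + pot_D (total debt w)"
      using * 1 unfolding runs_w by (simp add: runs_append_False add_ac)
    ultimately show ?thesis by blast
  next
    case 2
    have "w = x @ [False, True, True] @ (False # y)" by (simp add: w 2 numeral_2_eq_2)
    moreover have "total weight (x @ [False, False, False] @ (False # y))
        + pot_S (total debt (x @ [False, False, False] @ (False # y))) + 3 \<le> total weight w + pot_D (total debt w)"
      using * 2 unfolding runs_w by (simp add: runs_append_False add_ac)
    ultimately show ?thesis by blast
  next
    case 3
    let ?x = "x @ False # replicate s True"
    have "w = ?x @ [True, True, True] @ (False # y)"
      by (simp add: w 3 replicate_add eval_nat_numeral replicate_app_Cons_same)
    moreover have "runs 0 (?x @ [False, False, False] @ (False # y)) = runs 0 x @ s # 0 # 0 # 0 # runs 0 y"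
      by (simp add: runs_append_False runs_replicate runs_replicate[of _ _ "[]", simplified])
    then have "total weight (?x @ [False, False, False] @ (False # y))
        + pot_S (total debt (?x @ [False, False, False] @ (False # y))) + 3 \<le> total weight w + pot_D (total debt w)"
      using * 3 unfolding runs_w by (simp add: add_ac)
    ultimately show ?thesis by blast
  qed
qed

lemma sum_list_debt_False: "total debt (replicate N False) = 0"
  by (induction N) (simp_all add: debt_def)

section \<open>Staller's first reply in the locked classes\<close>

text \<open>Before the hit the total debt is \<open>c\<close>, and \<open>pot_S c = c\<close>.
  Compared with \<open>shrink_run\<close> and \<open>split_run\<close>, \<open>+ 3\<close> in place
  of \<open>+ 1\<close> means that this reply saves Dominator one move. It fails for the excluded
  hit, which takes exactly one vertex off a run of residue \<open>c\<close>.\<close>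

lemma hit_run:
  assumes "c \<in> {2, 3}" "1 \<le> r mod 4" "r mod 4 \<le> c" "t + debt r = c"
    and "x + y + 3 = r \<or> (x = 0 \<or> y = 0) \<and> (x + y + 2 = r \<or> x + y + 1 = r \<and> r mod 4 \<noteq> c)"
  shows "weight x + weight y + pot_D (t + (debt x + debt y)) + 3 \<le> weight r + c"
proof -
  obtain q s where x: "x = 4 * q + s" and s: "s \<in> {0, 1, 2, 3}" by (rule mod4_cases)
  obtain q' s' where y: "y = 4 * q' + s'" and s': "s' \<in> {0, 1, 2, 3}" by (rule mod4_cases)
  obtain d where d: "d \<in> {1, 2, 3}" "r = x + y + d"
    "d = 3 \<or> x = 0 \<or> y = 0" "d = 1 \<longrightarrow> r mod 4 \<noteq> c"
    using assms(5) by (elim disjE conjE) auto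
  have r: "r = 4 * (q + q') + (s + s' + d)" using x y d(2) by simp
  then have mod: "r mod 4 = (s + s' + d) mod 4" by (simp only: mod_mult_self4)
  \<comment> \<open>The debt of the other runs is forced by \<open>c\<close>, so it need not be
    quantified in the finite check.\<close>
  have t: "t = c - debt (s + s' + d)" using assms(4) unfolding r period by simp
  have "\<forall>c\<in>{2, 3}. \<forall>s\<in>{0, 1, 2, 3}. \<forall>s'\<in>{0, 1, 2, 3}. \<forall>d\<in>{1, 2, 3}.
      (d = 3 \<or> s = 0 \<or> s' = 0) \<and> (d = 1 \<longrightarrow> (s + s' + d) mod 4 \<noteq> c) \<and>
      1 \<le> (s + s' + d) mod 4 \<and> (s + s' + d) mod 4 \<le> c \<longrightarrow>
      weight s + weight s' + pot_D (c - debt (s + s' + d) + (debt s + debt s')) + 3 \<le> weight (s + s' + d) + c"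
    by code_simp
  moreover have "d = 3 \<or> s = 0 \<or> s' = 0" using d(3) x y by auto
  ultimately have "weight s + weight s' + pot_D (t + (debt s + debt s')) + 3 \<le> weight (s + s' + d) + c"
    using assms(1-3) s s' d(1,4) unfolding t mod by blast
  then show ?thesis unfolding r unfolding x y period by (simp add: add_ac)
qed

text \<open>The move \<open>b\<close> does take a single vertex off the run of residue
  \<open>c\<close>, but also one off the middle run, whose residue is smaller; the combined loss
  restores the saving.\<close>

lemma hit_two_runs:
  assumes "c \<in> {2, 3}" "(r + 1) mod 4 = c" "1 \<le> (s + 1) mod 4" "(s + 1) mod 4 < c"
    and "t + (debt (s + 1) + debt (r + 1)) = c"
  shows "weight s + weight r + pot_D (t + (debt s + debt r)) + 3 \<le> weight (s + 1) + weight (r + 1) + c"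
proof -
  obtain q u where s: "s = 4 * q + u" and u: "u \<in> {0, 1, 2, 3}" by (rule mod4_cases)
  obtain q' u' where r: "r = 4 * q' + u'" and u': "u' \<in> {0, 1, 2, 3}" by (rule mod4_cases)
  have mod: "(r + 1) mod 4 = (u' + 1) mod 4" "(s + 1) mod 4 = (u + 1) mod 4"
    unfolding r s add.assoc by simp_all
  have t: "t = c - (debt (u + 1) + debt (u' + 1))"
    using assms(5) unfolding r s add.assoc period by simp
  have "\<forall>c\<in>{2, 3}. \<forall>u\<in>{0, 1, 2, 3}. \<forall>u'\<in>{0, 1, 2, 3}.
      (u' + 1) mod 4 = c \<and> 1 \<le> (u + 1) mod 4 \<and> (u + 1) mod 4 < c \<longrightarrow>
      weight u + weight u' + pot_D (c - (debt (u + 1) + debt (u' + 1)) + (debt u + debt u')) + 3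
        \<le> weight (u + 1) + weight (u' + 1) + c"
    by code_simp
  then have "weight u + weight u' + pot_D (t + (debt u + debt u')) + 3 \<le> weight (u + 1) + weight (u' + 1) + c"
    using assms(1-4) u u' unfolding t mod by blast
  then show ?thesis unfolding r s add.assoc period by linarith
qed

text \<open>A hit takes only one vertex off a run just when it comes from right outside the run or
  the run has length 1.\<close>

lemma hit_lengths:
  fixes i lo hi :: nat
  defines "x \<equiv> i - 1 - lo" and "y \<equiv> hi - (i + 2)"
  assumes "1 \<le> lo" "lo < hi" "lo \<le> i + 1" "i \<le> hi"
  shows "x + y + 3 = hi - lo \<or>
    (x = 0 \<or> y = 0) \<and> (x + y + 2 = hi - lo \<or> x + y + 1 = hi - lo \<and> (i < lo \<or> i = hi \<or> hi - lo = 1))"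
  using assms(3-) unfolding x_def y_def by arith

text \<open>The arguments \<open>r\<close>, \<open>s\<close>, \<open>t\<close> stand for the lengths \<open>n - 1\<close>, \<open>m - 3\<close>, \<open>k\<close> of the runs left by the first
  move \<open>a\<close>, so that the graph has \<open>r + s + t + 4\<close> vertices.\<close>

definition fits :: "nat \<Rightarrow> nat \<Rightarrow> nat \<Rightarrow> bool" where
  "fits r s t \<longleftrightarrow> weight r + weight s + weight t + pot_S (debt r + debt s + debt t) + 2 \<le> 2 * ((r + s + t + 5) div 2)"

text \<open>For \<open>c\<close> 2 or 3 the weights and \<open>pot_S\<close> add up to the number of
  vertices, just too much for \<open>fits\<close>; the move saved in \<open>hit_run\<close> and
  \<open>hit_two_runs\<close> repairs this. The end run \<open>t\<close> alone has residue
  \<open>c\<close>, so it alone admits the excluded hit.\<close>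

definition locked :: "nat \<Rightarrow> nat \<Rightarrow> nat \<Rightarrow> nat \<Rightarrow> bool" where
  "locked c r s t \<longleftrightarrow> t mod 4 = c \<and> 1 \<le> r mod 4 \<and> r mod 4 < c \<and> 1 \<le> s mod 4 \<and> s mod 4 < c \<and>
    debt r + debt s + debt t = c \<and> weight r + weight s + weight t + c = r + s + t + 4"

lemma fits_period: "fits (4 * q + r) (4 * q' + s) (4 * q'' + t) \<longleftrightarrow> fits r s t"
proof -
  have "(4 * q + r + (4 * q' + s) + (4 * q'' + t) + 5) div 2 = 2 * (q + q' + q'') + (r + s + t + 5) div 2"
    by presburger
  then show ?thesis unfolding fits_def period by (simp add: add_ac)
qed

lemma locked_period: "locked c (4 * q + r) (4 * q' + s) (4 * q'' + t) \<longleftrightarrow> locked c r s t"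
  unfolding locked_def period by (auto simp: add_ac)

text \<open>The variables are the residues of \<open>n - 1\<close>, \<open>m - 3\<close> and
  \<open>k - 1\<close>. Starting at \<open>a\<close> leaves the end run \<open>k\<close>, hence
  \<open>t + 1\<close>; the mirrored triples belong to the start \<open>b\<close>. In the class left
  over \<open>n\<close>, \<open>m\<close>, \<open>k\<close> are all 2 modulo 4.\<close>

lemma residue_cases:
  assumes "r \<in> {0, 1, 2, 3}" "s \<in> {0, 1, 2, 3}" "t \<in> {0, 1, 2, 3}"
  shows "fits r s (t + 1) \<or> fits t s (r + 1) \<or> (\<exists>c\<in>{2, 3}. locked c r s (t + 1)) \<or>
    (\<exists>c\<in>{2, 3}. locked c t s (r + 1)) \<or> r = 1 \<and> s = 3 \<and> t = 1"
proof -
  have "\<forall>r\<in>{0, 1, 2, 3}. \<forall>s\<in>{0, 1, 2, 3}. \<forall>t\<in>{0, 1, 2, 3}.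
    fits r s (t + 1) \<or> fits t s (r + 1) \<or> (\<exists>c\<in>{2, 3}. locked c r s (t + 1)) \<or>
    (\<exists>c\<in>{2, 3}. locked c t s (r + 1)) \<or> r = 1 \<and> s = 3 \<and> t = 1"
    by code_simp
  then show ?thesis using assms by blast
qed

section \<open>The continuation principle\<close>

lemma finite_legal_moves: "finite (pverts G) \<Longrightarrow> finite (legal_moves G S)"
  by (simp add: legal_moves_def)

lemma staller_le:
  assumes "finite (pverts G)"
    and "\<And>v. v \<in> legal_moves G S \<Longrightarrow> Suc (moves_left G Dominator (insert v S)) \<le> b"
  shows "moves_left G Staller S \<le> b"
proof (cases "legal_moves G S = {}")
  case True
  then show ?thesis by (simp add: moves_left.simps[of G Staller S])
next
  case False
  have "Max ((\<lambda>v. moves_left G Dominator (insert v S)) ` legal_moves G S)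
      \<in> (\<lambda>v. moves_left G Dominator (insert v S)) ` legal_moves G S"
    using False assms(1) by (intro Max_in) (auto simp: finite_legal_moves)
  then show ?thesis
    using assms(2) False assms(1) by (auto simp: moves_left.simps[of G Staller S])
qed

lemma dominator_le:
  assumes "finite (pverts G)" "v \<in> legal_moves G S"
  shows "moves_left G Dominator S \<le> Suc (moves_left G Staller (insert v S))"
  using assms by (auto simp: moves_left.simps[of G Dominator S] finite_legal_moves intro!: Min_le)

lemma le_staller:
  assumes "finite (pverts G)" "v \<in> legal_moves G S"
  shows "Suc (moves_left G Dominator (insert v S)) \<le> moves_left G Staller S"
  using assms by (auto simp: moves_left.simps[of G Staller S] finite_legal_moves intro!: Max_ge)

lemma dominator_attained:
  assumes "finite (pverts G)" "legal_moves G S \<noteq> {}"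
  obtains v where "v \<in> legal_moves G S"
    "moves_left G Dominator S = Suc (moves_left G Staller (insert v S))"
proof -
  have "Min ((\<lambda>v. moves_left G Staller (insert v S)) ` legal_moves G S)
      \<in> (\<lambda>v. moves_left G Staller (insert v S)) ` legal_moves G S"
    using assms by (intro Min_in) (auto simp: finite_legal_moves)
  then show ?thesis
    using assms that by (auto simp: moves_left.simps[of G Dominator S])
qed

lemma no_legal_moves: "legal_moves G S = {} \<Longrightarrow> moves_left G p S = 0"
  by (simp add: moves_left.simps[of G p S])

lemma dominated_by_insert: "dominated_by G (insert v S) = closed_nbhd G v \<union> dominated_by G S"
  by (simp add: dominated_by_def)

lemma legal_moves_iff:
  "v \<in> legal_moves G S \<longleftrightarrow> v \<in> pverts G \<and> \<not> closed_nbhd G v \<subseteq> dominated_by G S"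
  by (auto simp: legal_moves_def)

text \<open>Induction on the game after \<open>S\<close>. Every move legal after \<open>S'\<close>
  is legal after \<open>S\<close>, so Staller gains nothing; Dominator copies an optimal move from
  the game after \<open>S\<close>.\<close>

lemma continuation_principle:
  assumes fin: "finite (pverts G)" and sub: "dominated_by G S \<subseteq> dominated_by G S'"
  shows "moves_left G p S' \<le> moves_left G p S"
  using assms
proof (induction G p S arbitrary: S' rule: moves_left.induct)
  case (1 G p S)
  have legal: "v \<in> legal_moves G S" if "v \<in> legal_moves G S'" for v
    using that 1 by (auto simp: legal_moves_iff)
  have IH: "moves_left G (opponent p) T \<le> moves_left G (opponent p) (insert v S)"
    if "v \<in> legal_moves G S" "dominated_by G (insert v S) \<subseteq> dominated_by G T" for v T
    using 1 that by blast
  show ?case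
  proof (cases p)
    case Staller
    show ?thesis unfolding Staller
    proof (rule staller_le[OF \<open>finite (pverts G)\<close>])
      fix v assume v: "v \<in> legal_moves G S'"
      have "moves_left G Dominator (insert v S') \<le> moves_left G Dominator (insert v S)"
        using IH[of v "insert v S'"] legal[OF v] Staller 1 by (auto simp: dominated_by_insert)
      also have "Suc \<dots> \<le> moves_left G Staller S"
        using le_staller[OF \<open>finite (pverts G)\<close> legal[OF v]] .
      finally show "Suc (moves_left G Dominator (insert v S')) \<le> moves_left G Staller S"
        by simp
    qed
  next
    case Dominator
    show ?thesis
    proof (cases "legal_moves G S' = {}")
      case False
      then obtain w where w: "w \<in> legal_moves G S'" by blast
      obtain v where v: "v \<in> legal_moves G S"
        and v_opt: "moves_left G Dominator S = Suc (moves_left G Staller (insert v S))"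
        using dominator_attained[OF \<open>finite (pverts G)\<close>] legal[OF w] by blast
      \<comment> \<open>If the copied move is illegal, all it would dominate is dominated already,
        so any legal move preserves the inclusion.\<close>
      define u where "u = (if v \<in> legal_moves G S' then v else w)"
      have u: "u \<in> legal_moves G S'" using w by (simp add: u_def)
      have "dominated_by G (insert v S) \<subseteq> dominated_by G (insert u S')"
        using v 1 by (auto simp: u_def dominated_by_insert legal_moves_iff)
      then have "moves_left G Staller (insert u S') \<le> moves_left G Staller (insert v S)"
        using IH[OF v] Dominator by auto
      with dominator_le[OF \<open>finite (pverts G)\<close> u] v_opt Dominator show ?thesis by simp
    qed (simp add: no_legal_moves)
  qed
qed

text \<open>Staller's move counts one, and forgetting what it dominated can only lengthen the rest
  of the game.\<close>

lemma staller_le_Suc_dominator: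
  assumes "finite (pverts G)"
  shows "moves_left G Staller S \<le> Suc (moves_left G Dominator S)"
proof (rule staller_le[OF assms])
  fix v
  show "Suc (moves_left G Dominator (insert v S)) \<le> Suc (moves_left G Dominator S)"
    using continuation_principle[OF assms, of S "insert v S"] by (simp add: dominated_by_insert)
qed

section \<open>A Hamiltonian path with one chord\<close>

lemma upt_split: "i \<le> j \<Longrightarrow> j \<le> l \<Longrightarrow> [i..<l] = [i..<j] @ [j..<l]"
  by (metis le_add_diff_inverse upt_add_eq_append)

lemma map_upt_const:
  assumes "\<And>j. lo \<le> j \<Longrightarrow> j < hi \<Longrightarrow> f j = c"
  shows "map f [lo..<hi] = replicate (hi - lo) c"
  using assms by (intro nth_equalityI) auto

lemma upt_Cons3: "j + 3 \<le> N \<Longrightarrow> [j..<N] = [j, j + 1, j + 2] @ [j + 3..<N]"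
  by (simp add: upt_conv_Cons eval_nat_numeral del: upt_Suc)

definition segment :: "nat \<Rightarrow> nat \<Rightarrow> nat set \<Rightarrow> nat list" where
  "segment lo hi U = runs 0 (map (\<lambda>i. i \<in> U) [lo..<hi])"

lemma segment_split:
  assumes "lo \<le> x" "x < hi" "x \<notin> U"
  shows "segment lo hi U = segment lo x U @ segment (x + 1) hi U"
proof -
  have "[lo..<hi] = [lo..<x] @ x # [x + 1..<hi]"
    using assms upt_split[of lo x hi] upt_conv_Cons[of x hi] by simp
  then show ?thesis using assms(3) by (simp add: segment_def runs_append_False)
qed

lemma segment_full:
  assumes "{lo..<hi} \<subseteq> U"
  shows "segment lo hi U = [hi - lo]"
proof -
  have "map (\<lambda>i. i \<in> U) [lo..<hi] = replicate (hi - lo) True"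
    using assms by (intro map_upt_const) auto
  then show ?thesis using runs_replicate[of 0 "hi - lo" "[]"] by (simp add: segment_def)
qed

lemma runs_replicate_False: "runs 0 (replicate d False @ w) = replicate d 0 @ runs 0 w"
  by (induction d) auto

lemma segment_window:
  fixes f :: "nat \<Rightarrow> nat"
  assumes "{lo..<hi} \<subseteq> U" "f 0 = 0" "lo \<le> i + 1" "i \<le> hi"
  shows "sum_list (map f (segment lo hi (U - {i - 1, i, i + 1}))) = f (i - 1 - lo) + f (hi - (i + 2))"
proof (cases "lo < hi")
  case False
  then show ?thesis using assms by (simp add: segment_def)
next
  case True
  \<comment> \<open>The window clipped to the segment, since it may stick out at either end.\<close>
  define l r where "l = max lo (i - 1)" and "r = min hi (i + 2)"
  have lr: "lo \<le> l" "l < r" "r \<le> hi" using True assms by (auto simp: l_def r_def)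
  have upt: "[lo..<hi] = [lo..<l] @ [l..<r] @ [r..<hi]"
    using lr upt_split[of lo l hi] upt_split[of l r hi] by (simp only: less_imp_le le_trans)
  have "map (\<lambda>j. j \<in> U - {i - 1, i, i + 1}) [lo..<hi] =
      replicate (l - lo) True @ replicate (r - l) False @ replicate (hi - r) True"
    unfolding upt map_append
  proof (intro arg_cong2[of _ _ _ _ append] map_upt_const)
    fix j
    show "j \<in> U - {i - 1, i, i + 1} \<longleftrightarrow> True" if "lo \<le> j" "j < l"
      using that assms lr by (auto simp: l_def)
    show "j \<in> U - {i - 1, i, i + 1} \<longleftrightarrow> False" if "l \<le> j" "j < r"
      using that by (auto simp: l_def r_def)
    show "j \<in> U - {i - 1, i, i + 1} \<longleftrightarrow> True" if "r \<le> j" "j < hi"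
      using that assms lr by (auto simp: r_def)
  qed
  \<comment> \<open>The first dominated position closes the left run; each further one adds an empty
    run, which counts 0 under \<open>f\<close>.\<close>
  also have "r - l = Suc (r - l - 1)" using lr by simp
  finally have "segment lo hi (U - {i - 1, i, i + 1}) = (l - lo) # replicate (r - l - 1) 0 @ [hi - r]"
    using runs_replicate[of 0 "hi - r" "[]"]
    by (simp add: segment_def runs_replicate runs_replicate_False)
  moreover have "l - lo = i - 1 - lo" "hi - r = hi - (i + 2)" by (auto simp: l_def r_def)
  ultimately show ?thesis using assms(2) by (simp add: sum_list_replicate)
qed

text \<open>\<open>\<phi>\<close> numbers the vertices along the Hamiltonian path; \<open>a\<close> and \<open>b\<close> have the numbers \<open>n + 1\<close> and \<open>n + m\<close>.\<close>

locale chorded_path =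
  fixes G :: "'a pair_pre_digraph" and \<phi> :: "'a \<Rightarrow> nat" and n m k :: nat
  assumes finite_verts: "finite (pverts G)"
    and bij: "bij_betw \<phi> (pverts G) {1..n + m + k}"
    and arcs_sub: "parcs G \<subseteq> pverts G \<times> pverts G"
    and arc_iff: "\<And>u v. u \<in> pverts G \<Longrightarrow> v \<in> pverts G \<Longrightarrow> (u, v) \<in> parcs G \<longleftrightarrow>
      \<phi> v = \<phi> u + 1 \<or> \<phi> u = \<phi> v + 1 \<or> \<phi> u = n + 1 \<and> \<phi> v = n + m \<or> \<phi> u = n + m \<and> \<phi> v = n + 1"
    and sizes: "m \<ge> 3" "n \<ge> 1" "k \<ge> 1"
begin

definition undominated :: "'a set \<Rightarrow> nat set" where
  "undominated S = \<phi> ` (pverts G - dominated_by G S)"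

text \<open>Positions 0 and \<open>n + m + k + 1\<close> belong to no vertex: they pad the word so that every move falls
  into a window of length 3.\<close>

definition word :: "'a set \<Rightarrow> bool list" where
  "word S = map (\<lambda>i. i \<in> undominated S) [0..<n + m + k + 2]"

lemma undominated_bounds: "undominated S \<subseteq> {1..n + m + k}"
  using bij by (auto simp: undominated_def bij_betw_def)

lemma nbhd_sub: "v \<in> pverts G \<Longrightarrow> closed_nbhd G v \<subseteq> pverts G"
  using arcs_sub by (auto simp: closed_nbhd_def)

lemma undominated_insert:
  assumes v: "v \<in> pverts G"
  shows "undominated (insert v S) = {i \<in> undominated S. \<not> (i = \<phi> v \<or> i = \<phi> v + 1 \<or> \<phi> v = i + 1 \<or>
    \<phi> v = n + 1 \<and> i = n + m \<or> \<phi> v = n + m \<and> i = n + 1)}"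
proof -
  have "u \<in> closed_nbhd G v \<longleftrightarrow> (\<phi> u = \<phi> v \<or> \<phi> u = \<phi> v + 1 \<or> \<phi> v = \<phi> u + 1 \<or>
    \<phi> v = n + 1 \<and> \<phi> u = n + m \<or> \<phi> v = n + m \<and> \<phi> u = n + 1)" if "u \<in> pverts G" for u
    using arc_iff[OF v that] bij v that by (auto simp: closed_nbhd_def bij_betw_def inj_on_def)
  then show ?thesis
    by (auto simp: undominated_def dominated_by_insert)
qed

lemma legal_iff: "v \<in> pverts G \<Longrightarrow> v \<in> legal_moves G S \<longleftrightarrow> undominated (insert v S) \<noteq> undominated S"
proof -
  assume v: "v \<in> pverts G"
  have inj: "inj_on \<phi> (pverts G)" using bij by (simp add: bij_betw_def)
  have "undominated (insert v S) = undominated S \<longleftrightarrow>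
      pverts G - dominated_by G (insert v S) = pverts G - dominated_by G S"
    unfolding undominated_def by (rule inj_on_image_eq_iff[OF inj]) auto
  also have "\<dots> \<longleftrightarrow> closed_nbhd G v \<subseteq> dominated_by G S"
    using nbhd_sub[OF v] by (auto simp: dominated_by_insert)
  finally show ?thesis using v by (auto simp: legal_moves_iff)
qed

section \<open>The potential bounds the game\<close>

definition chord_dominated :: "'a set \<Rightarrow> bool" where
  "chord_dominated S \<longleftrightarrow> n + 1 \<notin> undominated S \<and> n + m \<notin> undominated S"

lemma chord_dominated_insert: "v \<in> pverts G \<Longrightarrow> chord_dominated S \<Longrightarrow> chord_dominated (insert v S)"
  by (simp add: chord_dominated_def undominated_insert)

text \<open>With both ends of the chord dominated, a move changes only the window around
  \<open>\<phi> v\<close>. The length of \<open>x\<close> fixes where the window lies, so that a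
  window found in the word can be matched with a vertex.\<close>

lemma word_window:
  assumes v: "v \<in> pverts G" and S: "chord_dominated S"
  obtains x p q r y where "length x = \<phi> v - 1" "word S = x @ [p, q, r] @ y"
    "word (insert v S) = x @ [False, False, False] @ y"
    "v \<in> legal_moves G S \<longleftrightarrow> p \<or> q \<or> r"
proof -
  let ?N = "n + m + k" and ?i = "\<phi> v"
  have i: "1 \<le> ?i" "?i \<le> ?N" using bij v by (auto simp: bij_betw_def)
  have upt: "[0..<?N + 2] = [0..<?i - 1] @ [?i - 1, ?i, ?i + 1] @ [?i + 2..<?N + 2]"
  proof -
    have "[0..<?N + 2] = [0..<?i - 1] @ [?i - 1..<?N + 2]"
      using i by (intro upt_split) simp_all
    moreover have "[?i - 1..<?N + 2] = [?i - 1, ?i - 1 + 1, ?i - 1 + 2] @ [?i - 1 + 3..<?N + 2]"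
      using i by (intro upt_Cons3) simp
    moreover have "?i - 1 + 1 = ?i" "?i - 1 + 2 = ?i + 1" "?i - 1 + 3 = ?i + 2" using i by simp_all
    ultimately show ?thesis by (simp only:)
  qed
  have U: "undominated (insert v S) = {j \<in> undominated S. \<not> (j = ?i \<or> j = ?i + 1 \<or> ?i = j + 1)}"
    using S by (auto simp: undominated_insert[OF v] chord_dominated_def)
  have same: "map (\<lambda>j. j \<in> undominated (insert v S)) [0..<?i - 1] = map (\<lambda>j. j \<in> undominated S) [0..<?i - 1]"
    "map (\<lambda>j. j \<in> undominated (insert v S)) [?i + 2..<?N + 2] = map (\<lambda>j. j \<in> undominated S) [?i + 2..<?N + 2]"
    by (auto simp: U)
  show ?thesis
  proof (rule that)
    show "length (map (\<lambda>j. j \<in> undominated S) [0..<?i - 1]) = ?i - 1" by simp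
    show "word S = map (\<lambda>j. j \<in> undominated S) [0..<?i - 1] @
        [?i - 1 \<in> undominated S, ?i \<in> undominated S, ?i + 1 \<in> undominated S] @
        map (\<lambda>j. j \<in> undominated S) [?i + 2..<?N + 2]"
      by (simp only: word_def upt map_append list.map)
    have "(?i - 1 \<in> undominated (insert v S)) = False" "(?i \<in> undominated (insert v S)) = False"
      "(?i + 1 \<in> undominated (insert v S)) = False"
      using i by (auto simp: U)
    then show "word (insert v S) = map (\<lambda>j. j \<in> undominated S) [0..<?i - 1] @
        [False, False, False] @ map (\<lambda>j. j \<in> undominated S) [?i + 2..<?N + 2]"
      by (simp only: word_def upt map_append list.map same)
    show "v \<in> legal_moves G S \<longleftrightarrow>
        ?i - 1 \<in> undominated S \<or> ?i \<in> undominated S \<or> ?i + 1 \<in> undominated S"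
    proof -
      have "{j \<in> undominated S. \<not> (j = ?i \<or> j = ?i + 1 \<or> ?i = j + 1)} = undominated S \<longleftrightarrow>
          ?i - 1 \<notin> undominated S \<and> ?i \<notin> undominated S \<and> ?i + 1 \<notin> undominated S"
        (is "?l \<longleftrightarrow> ?r")
      proof
        assume ?l
        then have "\<forall>j\<in>undominated S. \<not> (j = ?i \<or> j = ?i + 1 \<or> ?i = j + 1)" by blast
        then show ?r using i by fastforce
      next
        assume ?r
        then show ?l by fastforce
      qed
      then show ?thesis unfolding legal_iff[OF v] U by blast
    qed
  qed
qed

text \<open>Both bounds go through one induction on the number of undominated vertices, since each
  player's bound rests on the opponent's.\<close>

lemma game_bounds:
  assumes "chord_dominated S"
  shows "2 * moves_left G Staller S \<le> total weight (word S) + pot_S (total debt (word S))"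
    and "2 * moves_left G Dominator S + 1 \<le> total weight (word S) + pot_D (total debt (word S))"
proof -
  have "2 * moves_left G Staller S \<le> total weight (word S) + pot_S (total debt (word S)) \<and>
    2 * moves_left G Dominator S + 1 \<le> total weight (word S) + pot_D (total debt (word S))"
    using assms
  proof (induction "card (undominated S)" arbitrary: S rule: less_induct)
    case less
    have IH: "2 * moves_left G Staller (insert v S)
          \<le> total weight (word (insert v S)) + pot_S (total debt (word (insert v S)))"
        "2 * moves_left G Dominator (insert v S) + 1
          \<le> total weight (word (insert v S)) + pot_D (total debt (word (insert v S)))"
      if "v \<in> legal_moves G S" for v
    proof -
      have v: "v \<in> pverts G" using that by (simp add: legal_moves_def)
      have "undominated (insert v S) \<subset> undominated S"
        using that legal_iff[OF v] by (auto simp: undominated_insert[OF v])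
      then have "card (undominated (insert v S)) < card (undominated S)"
        using undominated_bounds finite_subset by (intro psubset_card_mono) blast+
      with less.hyps chord_dominated_insert[OF v less.prems]
      show "2 * moves_left G Staller (insert v S)
          \<le> total weight (word (insert v S)) + pot_S (total debt (word (insert v S)))"
        "2 * moves_left G Dominator (insert v S) + 1
          \<le> total weight (word (insert v S)) + pot_D (total debt (word (insert v S)))"
        by blast+
    qed
    have "moves_left G Staller S \<le> (total weight (word S) + pot_S (total debt (word S))) div 2"
    proof (rule staller_le[OF finite_verts])
      fix v assume v: "v \<in> legal_moves G S"
      then have v': "v \<in> pverts G" by (simp add: legal_moves_def)
      obtain x p q r y where w: "word S = x @ [p, q, r] @ y"
        "word (insert v S) = x @ [False, False, False] @ y" and "v \<in> legal_moves G S \<longleftrightarrow> p \<or> q \<or> r"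
        by (rule word_window[OF v' less.prems])
      with v have "p \<or> q \<or> r" by simp
      show "Suc (moves_left G Dominator (insert v S)) \<le> (total weight (word S) + pot_S (total debt (word S))) div 2"
        using staller_window[OF \<open>p \<or> q \<or> r\<close>, of x y] IH(2)[OF v] unfolding w by linarith
    qed
    moreover have "2 * moves_left G Dominator S + 1 \<le> total weight (word S) + pot_D (total debt (word S))"
    \<comment> \<open>At the end of the game the offset in Dominator's bound is absorbed by
      \<open>pot_D 0 = 1\<close>.\<close>
    proof (cases "undominated S = {}")
      case True
      have "v \<notin> legal_moves G S" for v
        using True by (cases "v \<in> pverts G") (auto simp: legal_iff undominated_insert, simp add: legal_moves_def)
      then have "legal_moves G S = {}" by blast
      moreover have "word S = replicate (n + m + k + 2) False"
        using True by (simp add: word_def map_replicate_const)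
      then have "total debt (word S) = 0"
        by (simp only: sum_list_debt_False)
      ultimately show ?thesis by (simp add: no_legal_moves pot_D_def)
    next
      case False
      then obtain u where u: "u \<in> undominated S" by blast
      have bounds: "0 \<notin> undominated S" "n + m + k + 1 \<notin> undominated S"
        using undominated_bounds by fastforce+
      have "True \<in> set (word S)"
        using u undominated_bounds by (force simp: word_def)
      moreover have "word S = False # map (\<lambda>i. i \<in> undominated S) [1..<n + m + k + 2]"
        using bounds by (simp add: word_def upt_rec[of 0])
      moreover have "word S = map (\<lambda>i. i \<in> undominated S) [0..<n + m + k + 1] @ [False]"
        using bounds by (simp add: word_def)
      ultimately obtain x p r y where w: "word S = x @ [p, True, r] @ y"
        and best: "total weight (x @ [False, False, False] @ y) + pot_S (total debt (x @ [False, False, False] @ y)) + 3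
          \<le> total weight (word S) + pot_D (total debt (word S))"
        using dominator_window by blast
      \<comment> \<open>The word has one padding position at each end, so the middle of a window of
        length 3 always belongs to a vertex.\<close>
      have len: "length x + 3 \<le> n + m + k + 2"
        using arg_cong[OF w, of length] by (simp add: word_def)
      then have "length x + 1 \<in> \<phi> ` pverts G" using bij by (auto simp: bij_betw_def)
      then obtain v where v: "v \<in> pverts G" "\<phi> v = length x + 1" by auto
      obtain x' p' q' r' y' where w': "length x' = \<phi> v - 1" "word S = x' @ [p', q', r'] @ y'"
        "word (insert v S) = x' @ [False, False, False] @ y'"
        "v \<in> legal_moves G S \<longleftrightarrow> p' \<or> q' \<or> r'"
        by (rule word_window[OF v(1) less.prems])
      have "x' = x" "y' = y" q'
        using w w'(1,2) v(2) by auto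
      then show ?thesis
        using IH(1)[of v] w' best dominator_le[OF finite_verts, of v S] by auto
    qed
    ultimately show ?case by linarith
  qed
  then show "2 * moves_left G Staller S \<le> total weight (word S) + pot_S (total debt (word S))"
    and "2 * moves_left G Dominator S + 1 \<le> total weight (word S) + pot_D (total debt (word S))"
    by blast+
qed

section \<open>Opening moves\<close>

lemma vertex_at:
  assumes "1 \<le> i" "i \<le> n + m + k"
  obtains v where "v \<in> pverts G" "\<phi> v = i"
proof -
  have "i \<in> \<phi> ` pverts G" using assms bij by (simp add: bij_betw_def)
  then show ?thesis using that by auto
qed

lemma undominated_empty: "undominated {} = {1..n + m + k}"
  using bij by (simp add: undominated_def dominated_by_def bij_betw_def)

text \<open>More vertices than the four listed may be dominated, so this serves both after the first
  move \<open>a\<close> and after Staller's reply to it.\<close>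

lemma total_word_segments:
  assumes "f 0 = 0" "{n, n + 1, n + 2, n + m} \<inter> undominated S = {}"
  shows "total f (word S) = sum_list (map f (segment 1 n (undominated S))) +
    sum_list (map f (segment (n + 3) (n + m) (undominated S))) +
    sum_list (map f (segment (n + m + 1) (n + m + k + 1) (undominated S)))"
proof -
  let ?U = "undominated S" and ?N = "n + m + k"
  have [simp]: "segment i i ?U = [0]" for i by (simp add: segment_def)
  have out: "0 \<notin> ?U" "n \<notin> ?U" "n + 1 \<notin> ?U" "n + 2 \<notin> ?U" "n + m \<notin> ?U" "?N + 1 \<notin> ?U"
    using undominated_bounds[of S] assms(2) by auto
  have "runs 0 (word S) = segment 0 (?N + 2) ?U" by (simp add: word_def segment_def)
  also have "\<dots> = segment 0 0 ?U @ segment 1 n ?U @ segment (n + 1) (n + 1) ?U @ segment (n + 2) (n + 2) ?U @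
      segment (n + 3) (n + m) ?U @ segment (n + m + 1) (?N + 1) ?U @ segment (?N + 2) (?N + 2) ?U"
    using sizes segment_split[OF _ _ out(1), of 0 "?N + 2"] segment_split[OF _ _ out(2), of 1 "?N + 2"]
      segment_split[OF _ _ out(3), of "n + 1" "?N + 2"] segment_split[OF _ _ out(4), of "n + 2" "?N + 2"]
      segment_split[OF _ _ out(5), of "n + 3" "?N + 2"] segment_split[OF _ _ out(6), of "n + m + 1" "?N + 2"]
    by (simp add: eval_nat_numeral)
  finally show ?thesis using assms(1) by simp
qed

lemma undominated_a:
  assumes "v \<in> pverts G" "\<phi> v = n + 1"
  shows "undominated {v} = {1..n + m + k} - {n, n + 1, n + 2, n + m}"
  using assms sizes by (auto simp: undominated_insert undominated_empty)

lemma first_move: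
  assumes "v \<in> pverts G" "2 * moves_left G Staller {v} + 2 \<le> 2 * c"
  shows "game_domination_number G \<le> c"
proof -
  have "\<phi> v \<in> undominated {}" using assms(1) bij by (auto simp: undominated_empty bij_betw_def)
  then have "v \<in> legal_moves G {}"
    using assms(1) by (auto simp: legal_iff undominated_insert)
  from dominator_le[OF finite_verts this] show ?thesis
    using assms(2) by (simp add: game_domination_number_def)
qed

lemma bound_unlocked:
  assumes "weight (n - 1) + weight (m - 3) + weight k
      + pot_S (debt (n - 1) + debt (m - 3) + debt k) + 2 \<le> 2 * c"
  shows "game_domination_number G \<le> c"
proof -
  obtain v where v: "v \<in> pverts G" "\<phi> v = n + 1" using vertex_at[of "n + 1"] sizes by auto
  let ?U = "undominated {v}"
  have U: "?U = {1..n + m + k} - {n, n + 1, n + 2, n + m}" by (rule undominated_a[OF v])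
  have "{1..<n} \<subseteq> ?U" "{n + 3..<n + m} \<subseteq> ?U" "{n + m + 1..<n + m + k + 1} \<subseteq> ?U"
    using sizes by (auto simp: U)
  note full = this[THEN segment_full]
  have "total f (word {v}) = f (n - 1) + f (m - 3) + f k" if "f 0 = 0" for f
    using total_word_segments[of f "{v}", OF that] U unfolding full by simp
  then have "total weight (word {v}) = weight (n - 1) + weight (m - 3) + weight k"
    "total debt (word {v}) = debt (n - 1) + debt (m - 3) + debt k"
    by (simp_all add: weight_def debt_def)
  then show ?thesis
    using first_move[OF v(1)] game_bounds(1)[of "{v}"] assms sizes by (auto simp: chord_dominated_def U)
qed

text \<open>Dominator's two moves dominate six vertices and leave runs divisible by 4, of total
  weight \<open>?N - 6\<close> and without debt. With one move for Staller's reply the count is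
  \<open>3 + (?N - 6) / 2\<close>.\<close>

lemma bound_two_moves:
  assumes "n mod 4 = 2" "m mod 4 = 2" "k mod 4 = 2"
  shows "2 * game_domination_number G \<le> n + m + k"
proof -
  let ?N = "n + m + k"
  have ge: "n \<ge> 2" "m \<ge> 2" "k \<ge> 2"
    using assms mod_less_eq_dividend[of n 4] mod_less_eq_dividend[of m 4] mod_less_eq_dividend[of k 4] by simp_all
  obtain x where x: "x \<in> pverts G" "\<phi> x = n" using vertex_at[of n] sizes by auto
  obtain y where y: "y \<in> pverts G" "\<phi> y = n + m + 1" using vertex_at[of "n + m + 1"] sizes by auto
  let ?U = "undominated {y, x}"
  have Ux: "undominated {x} = {1..?N} - {n - 1, n, n + 1}"
    using x sizes by (auto simp: undominated_insert undominated_empty)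
  have U: "?U = {1..?N} - {n - 1, n, n + 1, n + m, n + m + 1, n + m + 2}"
    using y sizes by (auto simp: undominated_insert[of y] Ux)
  have nil: "segment i i ?U = [0]" for i by (simp add: segment_def)
  have "{1..<n - 1} \<subseteq> ?U" "{n + 2..<n + m} \<subseteq> ?U" "{n + m + 3..<?N + 1} \<subseteq> ?U"
    using sizes by (auto simp: U)
  note segments = this[THEN segment_full]
  have full: "segment 1 (n - 1) ?U = [n - 2]" "segment (n + 2) (n + m) ?U = [m - 2]"
    "segment (n + m + 3) (?N + 1) ?U = [k - 2]"
    unfolding segments by simp_all
  have out: "0 \<notin> ?U" "n - 1 \<notin> ?U" "n \<notin> ?U" "n + 1 \<notin> ?U" "n + m \<notin> ?U" "n + m + 1 \<notin> ?U" "n + m + 2 \<notin> ?U"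
    "?N + 1 \<notin> ?U"
    by (auto simp: U)
  have "runs 0 (word {y, x}) = segment 0 (?N + 2) ?U" by (simp add: word_def segment_def)
  also have "\<dots> = segment 0 0 ?U @ segment 1 (n - 1) ?U @ segment n n ?U @ segment (n + 1) (n + 1) ?U @
      segment (n + 2) (n + m) ?U @ segment (n + m + 1) (n + m + 1) ?U @ segment (n + m + 2) (n + m + 2) ?U @
      segment (n + m + 3) (?N + 1) ?U @ segment (?N + 2) (?N + 2) ?U"
    using ge segment_split[OF _ _ out(1), of 0 "?N + 2"] segment_split[OF _ _ out(2), of 1 "?N + 2"]
      segment_split[OF _ _ out(3), of n "?N + 2"] segment_split[OF _ _ out(4), of "n + 1" "?N + 2"]
      segment_split[OF _ _ out(5), of "n + 2" "?N + 2"] segment_split[OF _ _ out(6), of "n + m + 1" "?N + 2"]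
      segment_split[OF _ _ out(7), of "n + m + 2" "?N + 2"] segment_split[OF _ _ out(8), of "n + m + 3" "?N + 2"]
    by (simp add: eval_nat_numeral nil)
  finally have runs: "runs 0 (word {y, x}) = [0, n - 2, 0, 0, m - 2, 0, 0, k - 2, 0]"
    by (simp only: full nil append_Cons append_Nil)
  have "(n - 2) mod 4 = 0" "(m - 2) mod 4 = 0" "(k - 2) mod 4 = 0"
    using assms by presburger+
  then have w: "total weight (word {y, x}) = ?N - 6" and d: "total debt (word {y, x}) = 0"
    using ge by (simp_all add: runs weight_def debt_def)
  have "2 * moves_left G Staller {y, x} \<le> ?N - 6"
    using game_bounds(1)[of "{y, x}"] unfolding w d by (simp add: chord_dominated_def U pot_S_def)
  moreover have "n + m + 1 \<in> undominated {x}" using sizes by (simp add: Ux)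
  then have "y \<in> legal_moves G {x}"
    using y by (auto simp: legal_iff undominated_insert[of y])
  then have "moves_left G Dominator {x} \<le> Suc (moves_left G Staller {y, x})"
    by (rule dominator_le[OF finite_verts])
  \<comment> \<open>This removes Staller's unknown reply from the position, so that \<open>y\<close>
    is legal and its effect is known.\<close>
  moreover have "moves_left G Staller {x} \<le> Suc (moves_left G Dominator {x})"
    by (rule staller_le_Suc_dominator[OF finite_verts])
  moreover have "game_domination_number G \<le> moves_left G Staller {x} + 1"
    using first_move[OF x(1), of "moves_left G Staller {x} + 1"] by simp
  ultimately show ?thesis using ge by linarith
qed

text \<open>The aim after \<open>a\<close> and any reply is that weight and \<open>pot_D\<close>
  leave 3 to spare below \<open>?N\<close>: then at most \<open>(?N - 4) / 2\<close> moves follow,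
  and the two already made give \<open>?N / 2\<close>.\<close>

lemma bound_locked:
  assumes c: "c \<in> {2, 3}" "k mod 4 = c"
    and n: "1 \<le> (n - 1) mod 4" "(n - 1) mod 4 < c"
    and m: "1 \<le> (m - 3) mod 4" "(m - 3) mod 4 < c"
    and debt: "debt (n - 1) + debt (m - 3) + debt k = c"
    and weight: "weight (n - 1) + weight (m - 3) + weight k + c = n + m + k"
  shows "2 * game_domination_number G \<le> n + m + k"
proof -
  let ?N = "n + m + k"
  obtain a where a: "a \<in> pverts G" "\<phi> a = n + 1" using vertex_at[of "n + 1"] sizes by auto
  have U: "undominated {a} = {1..?N} - {n, n + 1, n + 2, n + m}" by (rule undominated_a[OF a])
  then have chord: "chord_dominated {a}" by (simp add: chord_dominated_def)
  have ge: "n \<ge> 2" "m \<ge> 4" "k \<ge> 2"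
    using n(1) m(1) c mod_less_eq_dividend[of "n - 1" 4] mod_less_eq_dividend[of "m - 3" 4]
      mod_less_eq_dividend[of k 4] by auto
  have "moves_left G Staller {a} \<le> (?N - 2) div 2"
  proof (rule staller_le[OF finite_verts])
    fix v assume legal: "v \<in> legal_moves G {a}"
    then have v: "v \<in> pverts G" by (simp add: legal_moves_def)
    define i where "i = \<phi> v"
    let ?U = "undominated {v, a}"
    have i: "1 \<le> i" "i \<le> ?N" using bij v by (auto simp: bij_betw_def i_def)
    have "?U = {j \<in> undominated {a}. \<not> (j = i \<or> j = i + 1 \<or> i = j + 1)}"
      using chord by (auto simp: undominated_insert[OF v] chord_dominated_def i_def)
    also have "\<dots> = undominated {a} - {i - 1, i, i + 1}"
      using i by (intro set_eqI) (simp, linarith)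
    finally have U': "?U = undominated {a} - {i - 1, i, i + 1}" .
    have bound: "2 * moves_left G Dominator {v, a} + 1
        \<le> total weight (word {v, a}) + pot_D (total debt (word {v, a}))"
      using chord_dominated_insert[OF v chord] by (rule game_bounds(2))
    have total: "total f (word {v, a}) = sum_list (map f (segment 1 n ?U)) +
        sum_list (map f (segment (n + 3) (n + m) ?U)) + sum_list (map f (segment (n + m + 1) (?N + 1) ?U))"
      if "f 0 = 0" for f
      using that by (intro total_word_segments[of f]) (auto simp: U' U)
    have full: "segment 1 n ?U = [n - 1]" if "n < i - 1"
      using that sizes by (subst segment_full) (auto simp: U' U)
    have full2: "segment (n + 3) (n + m) ?U = [m - 3]" if "i + 1 < n + 3 \<or> n + m \<le> i - 1"
      using that sizes by (subst segment_full) (auto simp: U' U)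
    have full3: "segment (n + m + 1) (?N + 1) ?U = [k]" if "i + 1 < n + m + 1"
      using that sizes by (subst segment_full) (auto simp: U' U)
    have win: "sum_list (map f (segment 1 n ?U)) = f (i - 1 - 1) + f (n - (i + 2))"
      if "f 0 = 0" "i \<le> n" for f :: "nat \<Rightarrow> nat"
      unfolding U' using that i sizes by (intro segment_window) (auto simp: U)
    have win2: "sum_list (map f (segment (n + 3) (n + m) ?U)) = f (i - 1 - (n + 3)) + f (n + m - (i + 2))"
      if "f 0 = 0" "n + 2 \<le> i" "i \<le> n + m" for f :: "nat \<Rightarrow> nat"
      unfolding U' using that i sizes by (intro segment_window) (auto simp: U)
    have win3: "sum_list (map f (segment (n + m + 1) (?N + 1) ?U)) = f (i - 1 - (n + m + 1)) + f (?N + 1 - (i + 2))"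
      if "f 0 = 0" "n + m \<le> i" for f :: "nat \<Rightarrow> nat"
      unfolding U' using that i sizes by (intro segment_window) (auto simp: U)
    have zero: "weight 0 = 0" "debt 0 = 0" by (simp_all add: weight_def debt_def)
    have "undominated {v, a} \<noteq> undominated {a}" using legal legal_iff[OF v] by simp
    then have "i \<noteq> n + 1" by (auto simp: U' U)
    \<comment> \<open>Hits on the first run, on the middle run, the move \<open>b\<close>, and hits
      on the end run; repeating \<open>a\<close> is illegal.\<close>
    then consider "i \<le> n" | "n + 2 \<le> i" "i < n + m" | "i = n + m" | "n + m < i" using i by linarith
    then have "total weight (word {v, a}) + pot_D (total debt (word {v, a})) + 3 \<le> ?N"
    proof cases
      case 1
      have s: "segment (n + 3) (n + m) ?U = [m - 3]" "segment (n + m + 1) (?N + 1) ?U = [k]"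
        using 1 sizes by (intro full2 full3; linarith)+
      have t: "total f (word {v, a}) = f (i - 1 - 1) + f (n - (i + 2)) + f (m - 3) + f k" if "f 0 = 0" for f
        using that unfolding total[of f, OF that] s win[of f, OF that 1] by simp
      have "weight (i - 1 - 1) + weight (n - (i + 2))
          + pot_D (debt (m - 3) + debt k + (debt (i - 1 - 1) + debt (n - (i + 2)))) + 3 \<le> weight (n - 1) + c"
      proof (rule hit_run[OF c(1)])
        show "1 \<le> (n - 1) mod 4" "(n - 1) mod 4 \<le> c" "debt (m - 3) + debt k + debt (n - 1) = c"
          using n debt by simp_all
        show "i - 1 - 1 + (n - (i + 2)) + 3 = n - 1 \<or> (i - 1 - 1 = 0 \<or> n - (i + 2) = 0) \<and>
            (i - 1 - 1 + (n - (i + 2)) + 2 = n - 1 \<or> i - 1 - 1 + (n - (i + 2)) + 1 = n - 1 \<and> (n - 1) mod 4 \<noteq> c)"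
          using hit_lengths[of 1 n i] 1 i ge n(2) by auto
      qed
      then show ?thesis
        using weight unfolding t[of weight, OF zero(1)] t[of debt, OF zero(2)] by (simp add: add_ac)
    next
      case 2
      have s: "segment 1 n ?U = [n - 1]" "segment (n + m + 1) (?N + 1) ?U = [k]"
        using 2 by (intro full full3; linarith)+
      have t: "total f (word {v, a}) = f (n - 1) + (f (i - 1 - (n + 3)) + f (n + m - (i + 2))) + f k" if "f 0 = 0" for f
        using that unfolding total[of f, OF that] s win2[of f, OF that 2(1) less_imp_le[OF 2(2)]] by simp
      have "weight (i - 1 - (n + 3)) + weight (n + m - (i + 2)) + pot_D (debt (n - 1) + debt k
          + (debt (i - 1 - (n + 3)) + debt (n + m - (i + 2)))) + 3 \<le> weight (m - 3) + c"
      proof (rule hit_run[OF c(1)])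
        show "1 \<le> (m - 3) mod 4" "(m - 3) mod 4 \<le> c" "debt (n - 1) + debt k + debt (m - 3) = c"
          using m debt by simp_all
        show "i - 1 - (n + 3) + (n + m - (i + 2)) + 3 = m - 3 \<or> (i - 1 - (n + 3) = 0 \<or> n + m - (i + 2) = 0) \<and>
            (i - 1 - (n + 3) + (n + m - (i + 2)) + 2 = m - 3 \<or>
             i - 1 - (n + 3) + (n + m - (i + 2)) + 1 = m - 3 \<and> (m - 3) mod 4 \<noteq> c)"
          using hit_lengths[of "n + 3" "n + m" i] 2 ge m(2) by auto
      qed
      then show ?thesis
        using weight unfolding t[of weight, OF zero(1)] t[of debt, OF zero(2)] by (simp add: add_ac)
    next
      case 3
      have s: "segment 1 n ?U = [n - 1]" using 3 sizes by (intro full) linarith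
      have diffs: "i - 1 - (n + 3) = m - 4" "n + m - (i + 2) = 0" "i - 1 - (n + m + 1) = 0" "?N + 1 - (i + 2) = k - 1"
        using 3 by simp_all
      have le: "n + 2 \<le> i" "i \<le> n + m" "n + m \<le> i" using 3 sizes by simp_all
      have t: "total f (word {v, a}) = f (n - 1) + f (m - 4) + f (k - 1)" if "f 0 = 0" for f
        using that unfolding total[of f, OF that] s win2[of f, OF that le(1,2)] win3[of f, OF that le(3)] diffs by simp
      have "weight (m - 4) + weight (k - 1) + pot_D (debt (n - 1) + (debt (m - 4) + debt (k - 1))) + 3
          \<le> weight (m - 4 + 1) + weight (k - 1 + 1) + c"
      proof (rule hit_two_runs[OF c(1)])
        have *: "m - 4 + 1 = m - 3" "k - 1 + 1 = k" using ge by simp_all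
        show "(k - 1 + 1) mod 4 = c" "1 \<le> (m - 4 + 1) mod 4" "(m - 4 + 1) mod 4 < c"
          "debt (n - 1) + (debt (m - 4 + 1) + debt (k - 1 + 1)) = c"
          unfolding * using c m debt by simp_all
      qed
      moreover have "m - 4 + 1 = m - 3" "k - 1 + 1 = k" using ge by simp_all
      ultimately show ?thesis
        using weight unfolding t[of weight, OF zero(1)] t[of debt, OF zero(2)] by (simp add: add_ac)
    next
      case 4
      have s: "segment 1 n ?U = [n - 1]" "segment (n + 3) (n + m) ?U = [m - 3]"
        using 4 sizes by (intro full full2; linarith)+
      have t: "total f (word {v, a}) = f (n - 1) + f (m - 3) + (f (i - 1 - (n + m + 1)) + f (?N + 1 - (i + 2)))" if "f 0 = 0" for f
        using that unfolding total[of f, OF that] s win3[of f, OF that less_imp_le[OF 4]] by simp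
      have "weight (i - 1 - (n + m + 1)) + weight (?N + 1 - (i + 2)) + pot_D (debt (n - 1) + debt (m - 3)
          + (debt (i - 1 - (n + m + 1)) + debt (?N + 1 - (i + 2)))) + 3 \<le> weight k + c"
      proof (rule hit_run[OF c(1)])
        show "1 \<le> k mod 4" "k mod 4 \<le> c" "debt (n - 1) + debt (m - 3) + debt k = c"
          using c debt by auto
        \<comment> \<open>Here the selected vertex lies inside the run, up to the leaf at its end;
          as \<open>k\<close> is at least 2, it takes at least two vertices.\<close>
        show "i - 1 - (n + m + 1) + (?N + 1 - (i + 2)) + 3 = k \<or> (i - 1 - (n + m + 1) = 0 \<or> ?N + 1 - (i + 2) = 0) \<and>
            (i - 1 - (n + m + 1) + (?N + 1 - (i + 2)) + 2 = k \<or>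
             i - 1 - (n + m + 1) + (?N + 1 - (i + 2)) + 1 = k \<and> k mod 4 \<noteq> c)"
          using hit_lengths[of "n + m + 1" "?N + 1" i] 4 ge i by auto
      qed
      then show ?thesis
        using weight unfolding t[of weight, OF zero(1)] t[of debt, OF zero(2)] by (simp add: add_ac)
    qed
    with bound show "Suc (moves_left G Dominator (insert v {a})) \<le> (?N - 2) div 2" by linarith
  qed
  then have "2 * moves_left G Staller {a} + 2 \<le> 2 * (?N div 2)" using ge le_div_geq[of 2 ?N] by simp
  from first_move[OF a(1) this] show ?thesis by linarith
qed

lemma bound_fits:
  assumes "fits (n - 1) (m - 3) k"
  shows "game_domination_number G \<le> (n + m + k + 1) div 2"
proof -
  have "n - 1 + (m - 3) + k + 5 = n + m + k + 1" using sizes by simp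
  with assms have "weight (n - 1) + weight (m - 3) + weight k + pot_S (debt (n - 1) + debt (m - 3) + debt k) + 2
      \<le> 2 * ((n + m + k + 1) div 2)"
    by (simp only: fits_def)
  then show ?thesis by (rule bound_unlocked)
qed

lemma bound_locked':
  assumes "c \<in> {2, 3}" "locked c (n - 1) (m - 3) k"
  shows "game_domination_number G \<le> (n + m + k + 1) div 2"
proof -
  have "2 * game_domination_number G \<le> n + m + k"
    by (rule bound_locked[of c]) (use assms sizes in \<open>auto simp: locked_def\<close>)
  then show ?thesis by linarith
qed

section \<open>Reflection and the final case analysis\<close>

text \<open>Reading the path backwards exchanges \<open>n\<close> with \<open>k\<close> and
  \<open>a\<close> with \<open>b\<close>, so the bounds for the start \<open>a\<close> carry over to
  the start \<open>b\<close>.\<close>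

lemma reflect: "chorded_path G (\<lambda>v. n + m + k + 1 - \<phi> v) k m n"
proof
  let ?N = "n + m + k"
  have range: "1 \<le> \<phi> v \<and> \<phi> v \<le> ?N" if "v \<in> pverts G" for v
    using that bij by (auto simp: bij_betw_def)
  have "bij_betw (\<lambda>i. ?N + 1 - i) {1..?N} {1..?N}"
    by (rule bij_betw_byWitness[where f' = "\<lambda>i. ?N + 1 - i"]) auto
  from bij_betw_trans[OF bij this]
  show "bij_betw (\<lambda>v. ?N + 1 - \<phi> v) (pverts G) {1..k + m + n}"
    by (simp add: comp_def add_ac)
  show "(u, v) \<in> parcs G \<longleftrightarrow> ?N + 1 - \<phi> v = ?N + 1 - \<phi> u + 1 \<or> ?N + 1 - \<phi> u = ?N + 1 - \<phi> v + 1 \<or>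
      ?N + 1 - \<phi> u = k + 1 \<and> ?N + 1 - \<phi> v = k + m \<or> ?N + 1 - \<phi> u = k + m \<and> ?N + 1 - \<phi> v = k + 1"
    if "u \<in> pverts G" "v \<in> pverts G" for u v
    unfolding arc_iff[OF that] using range[OF that(1)] range[OF that(2)] sizes by arith
qed (use finite_verts arcs_sub sizes in auto)

theorem half_bound: "game_domination_number G \<le> (n + m + k + 1) div 2"
proof -
  interpret R: chorded_path G "\<lambda>v. n + m + k + 1 - \<phi> v" k m n by (rule reflect)
  obtain q r where r: "n - 1 = 4 * q + r" "r \<in> {0, 1, 2, 3}" by (rule mod4_cases)
  obtain q' s where s: "m - 3 = 4 * q' + s" "s \<in> {0, 1, 2, 3}" by (rule mod4_cases)
  obtain q'' t where t: "k - 1 = 4 * q'' + t" "t \<in> {0, 1, 2, 3}" by (rule mod4_cases)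
  have n: "n = 4 * q + (r + 1)" and k: "k = 4 * q'' + (t + 1)" using r t sizes by simp_all
  have sum: "k + m + n = n + m + k" by simp
  \<comment> \<open>Periodicity turns the statement about residues back into one about the actual
    run lengths.\<close>
  note cases = residue_cases[OF r(2) s(2) t(2), folded fits_period[of q r q' s q'' "t + 1"]
    fits_period[of q'' t q' s q "r + 1"] locked_period[of _ q r q' s q'' "t + 1"]
    locked_period[of _ q'' t q' s q "r + 1"], folded r(1) s(1) t(1) n k]
  then show ?thesis
  proof (elim disjE bexE)
    assume "r = 1 \<and> s = 3 \<and> t = 1"
    moreover have "m = 4 * q' + (s + 3)" using s sizes by simp
    ultimately have "n mod 4 = 2" "m mod 4 = 2" "k mod 4 = 2" using n k by presburger+
    from bound_two_moves[OF this] show ?thesis by linarith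
  qed (use bound_fits bound_locked' R.bound_fits R.bound_locked' sum in \<open>auto simp only:\<close>)
qed

end

section \<open>The graph as a path with one chord\<close>

text \<open>Counting starts at the end away from \<open>p\<close>, so that the attached end comes
  last.\<close>

lemma path_layout:
  assumes "p \<in> path_ends n" "n \<ge> 1"
  obtains f where "bij_betw f {..<n} {1..n}" "f p = n"
    "\<And>u v. u < n \<Longrightarrow> v < n \<Longrightarrow> (u, v) \<in> parcs (path_graph n) \<longleftrightarrow> f v = f u + 1 \<or> f u = f v + (1::nat)"
proof -
  have path: "(u, v) \<in> parcs (path_graph n) \<longleftrightarrow>
      (Suc u < n \<and> v = Suc u) \<or> (Suc v < n \<and> u = Suc v)" for u v
    by (auto simp: path_graph_def parcs_mk_symmetric)
  from assms consider "p = n - 1" | "p = 0" by (auto simp: path_ends_def)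
  then show ?thesis
  proof cases
    case 1
    show ?thesis
    proof (rule that[of Suc])
      show "bij_betw Suc {..<n} {1..n}"
        by (rule bij_betw_byWitness[where f' = "\<lambda>i. i - 1"]) auto
    qed (use 1 assms in \<open>auto simp: path\<close>)
  next
    case 2
    show ?thesis
    proof (rule that[of "\<lambda>i. n - i"])
      show "bij_betw (\<lambda>i. n - i) {..<n} {1..n}"
        by (rule bij_betw_byWitness[where f' = "\<lambda>i. n - i"]) auto
    qed (use 2 assms in \<open>auto simp: path\<close>)
  qed
qed

text \<open>Walking round the cycle from \<open>a\<close> away from \<open>b\<close> reaches
  \<open>b\<close> last; the edge \<open>ab\<close> becomes the chord from 1 to
  \<open>m\<close>.\<close>

lemma cycle_layout:
  assumes "(a, b) \<in> parcs (cycle_graph m)" "m \<ge> 3"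
  obtains f where "bij_betw f {..<m} {1..m}" "f a = 1" "f b = m"
    "\<And>u v. u < m \<Longrightarrow> v < m \<Longrightarrow> (u, v) \<in> parcs (cycle_graph m) \<longleftrightarrow>
      f v = f u + 1 \<or> f u = f v + (1::nat) \<or> f u = 1 \<and> f v = m \<or> f u = m \<and> f v = 1"
proof -
  have cyc: "(u, v) \<in> parcs (cycle_graph m) \<longleftrightarrow>
      (u < m \<and> v = Suc u mod m) \<or> (v < m \<and> u = Suc v mod m)" for u v
    by (auto simp: cycle_graph_def parcs_mk_symmetric)
  have mod: "Suc u mod m = (if u + 1 = m then 0 else u + 1)" if "u < m" for u
    using that by (auto simp: mod_less)
  from assms have ab: "a < m" "b < m" by (auto simp: cyc)
  from assms consider "b = Suc a mod m" | "a = Suc b mod m" by (auto simp: cyc)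
  then show ?thesis
  proof cases
    case 1
    \<comment> \<open>As \<open>b\<close> is the successor of \<open>a\<close>, the walk goes
      downwards and wraps round after 0.\<close>
    let ?f = "\<lambda>i. if i \<le> a then a - i + 1 else a + m - i + 1"
    show ?thesis
    proof (rule that[of ?f])
      show "bij_betw ?f {..<m} {1..m}"
        using ab by (intro bij_betw_byWitness[where f' = "\<lambda>j. if j \<le> a + 1 then a + 1 - j else a + m + 1 - j"]) auto
      show "?f b = m" using 1 ab mod[OF ab(1)] assms(2) by (auto split: if_splits)
      show "(u, v) \<in> parcs (cycle_graph m) \<longleftrightarrow>
        ?f v = ?f u + 1 \<or> ?f u = ?f v + (1::nat) \<or> ?f u = 1 \<and> ?f v = m \<or> ?f u = m \<and> ?f v = 1"
        if "u < m" "v < m" for u v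
        using that ab assms(2) unfolding cyc mod[OF that(1)] mod[OF that(2)] by (auto split: if_splits)
    qed auto
  next
    case 2
    let ?f = "\<lambda>i. if i < a then i + m - a + 1 else i - a + 1"
    show ?thesis
    proof (rule that[of ?f])
      show "bij_betw ?f {..<m} {1..m}"
        using ab by (intro bij_betw_byWitness[where f' = "\<lambda>j. if j + a \<le> m then j + a - 1 else j + a - 1 - m"]) auto
      show "?f b = m" using 2 ab mod[OF ab(2)] assms(2) by (auto split: if_splits)
      show "(u, v) \<in> parcs (cycle_graph m) \<longleftrightarrow>
        ?f v = ?f u + 1 \<or> ?f u = ?f v + (1::nat) \<or> ?f u = 1 \<and> ?f v = m \<or> ?f u = m \<and> ?f v = 1"
        if "u < m" "v < m" for u v
        using that ab assms(2) unfolding cyc mod[OF that(1)] mod[OF that(2)] by (auto split: if_splits)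
    qed auto
  qed
qed

lemma T_graph_chorded_path:
  assumes m: "m \<ge> 3" and n: "n \<ge> 1" and k: "k \<ge> 1"
    and ab: "(a, b) \<in> parcs (cycle_graph m)" and p: "p \<in> path_ends n" and q: "q \<in> path_ends k"
  obtains \<phi> where "chorded_path (T_graph m n k a b p q) \<phi> n m k"
proof -
  let ?T = "T_graph m n k a b p q" and ?N = "n + m + k"
  obtain c where c: "bij_betw c {..<m} {1..m}" "c a = 1" "c b = m"
    and c_arc: "\<And>u v. u < m \<Longrightarrow> v < m \<Longrightarrow> (u, v) \<in> parcs (cycle_graph m) \<longleftrightarrow>
      c v = c u + 1 \<or> c u = c v + (1::nat) \<or> c u = 1 \<and> c v = m \<or> c u = m \<and> c v = 1"
    using cycle_layout[OF ab m] by blast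
  obtain x where x: "bij_betw x {..<n} {1..n}" "x p = n"
    and x_arc: "\<And>u v. u < n \<Longrightarrow> v < n \<Longrightarrow> (u, v) \<in> parcs (path_graph n) \<longleftrightarrow> x v = x u + 1 \<or> x u = x v + (1::nat)"
    using path_layout[OF p n] by blast
  obtain y where y: "bij_betw y {..<k} {1..k}" "y q = k"
    and y_arc: "\<And>u v. u < k \<Longrightarrow> v < k \<Longrightarrow> (u, v) \<in> parcs (path_graph k) \<longleftrightarrow> y v = y u + 1 \<or> y u = y v + (1::nat)"
    using path_layout[OF q k] by blast
  have less: "a < m" "b < m" "p < n" "q < k"
    using ab p q m n k by (auto simp: cycle_graph_def parcs_mk_symmetric path_ends_def)
  \<comment> \<open>The second path is reversed: \<open>q\<close> has number \<open>k\<close> in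
    \<open>y\<close> and so gets \<open>n + m + 1\<close>, next to \<open>b\<close>.\<close>
  define \<phi> where "\<phi> = case_sum (\<lambda>i. n + c i) (case_sum x (\<lambda>j. ?N + 1 - y j))"
  have \<phi>: "\<phi> (Inl i) = n + c i" "\<phi> (Inr (Inl i)) = x i" "\<phi> (Inr (Inr i)) = ?N + 1 - y i" for i
    by (simp_all add: \<phi>_def)
  have V: "pverts ?T = {..<m} <+> {..<n} <+> {..<k}"
    by (simp add: T_graph_def add_edge_def disjoint_union_def cycle_graph_def path_graph_def)
  have E: "(Inl u, Inl v) \<in> parcs ?T \<longleftrightarrow> (u, v) \<in> parcs (cycle_graph m)"
    "(Inr (Inl u), Inr (Inl v)) \<in> parcs ?T \<longleftrightarrow> (u, v) \<in> parcs (path_graph n)"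
    "(Inr (Inr u), Inr (Inr v)) \<in> parcs ?T \<longleftrightarrow> (u, v) \<in> parcs (path_graph k)"
    "(Inl u, Inr (Inl v)) \<in> parcs ?T \<longleftrightarrow> u = a \<and> v = p"
    "(Inr (Inl v), Inl u) \<in> parcs ?T \<longleftrightarrow> u = a \<and> v = p"
    "(Inl u, Inr (Inr v)) \<in> parcs ?T \<longleftrightarrow> u = b \<and> v = q"
    "(Inr (Inr v), Inl u) \<in> parcs ?T \<longleftrightarrow> u = b \<and> v = q"
    "(Inr (Inl u), Inr (Inr v)) \<notin> parcs ?T" "(Inr (Inr v), Inr (Inl u)) \<notin> parcs ?T" for u v
    unfolding T_graph_def add_edge_def disjoint_union_def by (auto simp: image_iff) force+
  have c_range: "1 \<le> c i \<and> c i \<le> m" "c i = 1 \<longleftrightarrow> i = a" "c i = m \<longleftrightarrow> i = b" if "i < m" for i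
    using that c less by (auto simp: bij_betw_def inj_on_def)
  have x_range: "1 \<le> x i \<and> x i \<le> n" "x i = n \<longleftrightarrow> i = p" if "i < n" for i
    using that x less by (auto simp: bij_betw_def inj_on_def)
  have y_range: "1 \<le> y i \<and> y i \<le> k" "y i = k \<longleftrightarrow> i = q" if "i < k" for i
    using that y less by (auto simp: bij_betw_def inj_on_def)
  interpret pair_graph ?T using m less by (rule pair_graph_T_graph)
  show ?thesis
  proof (rule that[of \<phi>], unfold_locales)
    show "finite (pverts ?T)" by (simp add: V)
    show "parcs ?T \<subseteq> pverts ?T \<times> pverts ?T"
      using in_arcsD1 in_arcsD2 by auto
    have "\<phi> ` pverts ?T = (\<lambda>i. n + i) ` c ` {..<m} \<union> x ` {..<n} \<union> (\<lambda>i. ?N + 1 - i) ` y ` {..<k}"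
      by (auto simp: V \<phi> image_iff Plus_def image_Un image_image)
    also have "\<dots> = (\<lambda>i. n + i) ` {1..m} \<union> {1..n} \<union> (\<lambda>i. ?N + 1 - i) ` {1..k}"
      using c(1) x(1) y(1) by (simp only: bij_betw_imp_surj_on)
    also have "(\<lambda>i. n + i) ` {1..m} = {n + 1..n + m}" by (simp add: image_add_atLeastAtMost)
    also have "(\<lambda>i. ?N + 1 - i) ` {1..k} = {n + m + 1..?N}"
      by (rule bij_betw_imp_surj_on[OF bij_betw_byWitness[where f' = "\<lambda>i. ?N + 1 - i"]]) auto
    also have "{n + 1..n + m} \<union> {1..n} \<union> {n + m + 1..?N} = {1..?N}" by auto
    finally have im: "\<phi> ` pverts ?T = {1..?N}" .
    moreover have "card (pverts ?T) = ?N" by (simp add: V card_Plus)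
    ultimately have "inj_on \<phi> (pverts ?T)" by (intro eq_card_imp_inj_on) (simp_all add: V)
    with im show "bij_betw \<phi> (pverts ?T) {1..?N}" by (simp add: bij_betw_def)
    fix u v assume uv: "u \<in> pverts ?T" "v \<in> pverts ?T"
    have cases: "(\<exists>i<m. w = Inl i) \<or> (\<exists>i<n. w = Inr (Inl i)) \<or> (\<exists>i<k. w = Inr (Inr i))"
      if "w \<in> pverts ?T" for w
      using that by (auto simp: V)
    show "(u, v) \<in> parcs ?T \<longleftrightarrow> \<phi> v = \<phi> u + 1 \<or> \<phi> u = \<phi> v + 1 \<or>
        \<phi> u = n + 1 \<and> \<phi> v = n + m \<or> \<phi> u = n + m \<and> \<phi> v = n + 1"
      using cases[OF uv(1)] cases[OF uv(2)]
    proof (elim disjE exE conjE)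
      fix i j assume ij: "i < m" "u = Inl i" "j < m" "v = Inl j"
      show ?thesis unfolding ij(2,4) E \<phi> c_arc[OF ij(1,3)] by auto
    next
      fix i j assume ij: "i < n" "u = Inr (Inl i)" "j < n" "v = Inr (Inl j)"
      show ?thesis unfolding ij(2,4) E \<phi> x_arc[OF ij(1,3)] using x_range[OF ij(1)] x_range[OF ij(3)] by auto
    next
      fix i j assume ij: "i < k" "u = Inr (Inr i)" "j < k" "v = Inr (Inr j)"
      show ?thesis unfolding ij(2,4) E \<phi> y_arc[OF ij(1,3)]
        using y_range(1)[OF ij(1)] y_range(1)[OF ij(3)] m by arith
    next
      fix i j assume ij: "i < m" "u = Inl i" "j < n" "v = Inr (Inl j)"
      show ?thesis unfolding ij(2,4) E \<phi> c_range(2)[OF ij(1), symmetric] x_range(2)[OF ij(3), symmetric]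
        using c_range(1)[OF ij(1)] x_range(1)[OF ij(3)] m by linarith
    next
      fix i j assume ij: "i < n" "u = Inr (Inl i)" "j < m" "v = Inl j"
      show ?thesis unfolding ij(2,4) E \<phi> c_range(2)[OF ij(3), symmetric] x_range(2)[OF ij(1), symmetric]
        using c_range(1)[OF ij(3)] x_range(1)[OF ij(1)] m by linarith
    next
      fix i j assume ij: "i < m" "u = Inl i" "j < k" "v = Inr (Inr j)"
      show ?thesis unfolding ij(2,4) E \<phi> c_range(3)[OF ij(1), symmetric] y_range(2)[OF ij(3), symmetric]
        using c_range(1)[OF ij(1)] y_range(1)[OF ij(3)] m by arith
    next
      fix i j assume ij: "i < k" "u = Inr (Inr i)" "j < m" "v = Inl j"
      show ?thesis unfolding ij(2,4) E \<phi> c_range(3)[OF ij(3), symmetric] y_range(2)[OF ij(1), symmetric]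
        using c_range(1)[OF ij(3)] y_range(1)[OF ij(1)] m by arith
    next
      fix i j assume ij: "i < n" "u = Inr (Inl i)" "j < k" "v = Inr (Inr j)"
      show ?thesis using E(8) unfolding ij(2,4) \<phi> using x_range(1)[OF ij(1)] y_range(1)[OF ij(3)] m by auto
    next
      fix i j assume ij: "i < k" "u = Inr (Inr i)" "j < n" "v = Inr (Inl j)"
      show ?thesis using E(9) unfolding ij(2,4) \<phi> using x_range(1)[OF ij(3)] y_range(1)[OF ij(1)] m by auto
    qed
  qed (use m n k in auto)
qed

theorem theorem4p2:
  fixes m n k a b p q :: nat
  assumes "m \<ge> 3" and "n \<ge> 1" and "k \<ge> 1"
    and "(a, b) \<in> parcs (cycle_graph m)"
    and "p \<in> path_ends n" and "q \<in> path_ends k"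
  shows "card (pverts (T_graph m n k a b p q)) = m + n + k
    \<and> int (game_domination_number (T_graph m n k a b p q))
        \<le> \<lceil>real (card (pverts (T_graph m n k a b p q))) / 2\<rceil>"
proof
  obtain \<phi> where "chorded_path (T_graph m n k a b p q) \<phi> n m k"
    using T_graph_chorded_path assms by blast
  then have "game_domination_number (T_graph m n k a b p q) \<le> (n + m + k + 1) div 2"
    by (rule chorded_path.half_bound)
  moreover show card: "card (pverts (T_graph m n k a b p q)) = m + n + k"
    by (simp add: T_graph_def add_edge_def disjoint_union_def cycle_graph_def path_graph_def card_Plus)
  have "int ((n + m + k + 1) div 2) \<le> \<lceil>real (m + n + k) / 2\<rceil>"
    by (simp add: le_ceiling_iff)
  ultimately show "int (game_domination_number (T_graph m n k a b p q))
      \<le> \<lceil>real (card (pverts (T_graph m n k a b p q))) / 2\<rceil>"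
    unfolding card by linarith
qed

end
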